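(* Let $(A,\cdot,\alpha)$ be a finite-dimensional regular Hom-pre-Lie algebra, $(V,\beta,\rho,\mu)$ a finite-dimensional representation of $(A,\cdot,\alpha)$ with $\beta$ invertible, and $T:V\to A$ a linear map satisfying $T\circ\beta=\alpha\circ T$. Let $\bar T\in\otimes^2(A\oplus V^* )$ be defined by $\bar T(\xi+u,\eta+v)=\langle T(u),\eta\rangle$ for all $\xi+u,\eta+v\in A^*\oplus V$, and let $\sigma$ be the flip on $\otimes^2(A\oplus V^* )$. Then $r=\bar T+\sigma(\bar T)$ is a Hom-$\mathfrak s$-matrix in the semidirect product Hom-pre-Lie algebra $A\ltimes_{(\rho^\star-\mu^\star,-\mu^\star)}V^*$ if and only if $T\circ\beta:V\to A$ is a Hom-$\mathcal O$-operator on $(A,\cdot,\alpha)$ associated to the representation $(V,\beta,\rho,\mu)$.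
   Context: All vector spaces are finite-dimensional over a field; $\mathfrak{gl}(V)$ is the space of linear endomorphisms of $V$; for a linear map $f$ between vector spaces $f^*$ is the usual transpose. Hom-pre-Lie algebra: $(A,\cdot,\alpha)$ with $\cdot$ bilinear, $\alpha\in\mathfrak{gl}(A)$, $\alpha(x\cdot y)=\alpha(x)\cdot\alpha(y)$ and $(x\cdot y)\cdot\alpha(z)-\alpha(x)\cdot(y\cdot z)=(y\cdot x)\cdot\alpha(z)-\alpha(y)\cdot(x\cdot z)$; regular means $\alpha$ invertible. $[x,y]=x\cdot y-y\cdot x$. Representation $(V,\beta,\rho,\mu)$ of $(A,\cdot,\alpha)$: $\beta\in\mathfrak{gl}(V)$, linear maps $\rho,\mu:A\to\mathfrak{gl}(V)$ with $\rho(\alpha(x))\beta=\beta\rho(x)$, $\rho([x,y])\beta=\rho(\alpha(x))\rho(y)-\rho(\alpha(y))\rho(x)$, $\beta\mu(x)=\mu(\alpha(x))\beta$, and $\mu(\alpha(y))\mu(x)-\mu(x\cdot y)\beta=\mu(\alpha(y))\rho(x)-\rho(\alpha(x))\mu(y)$. Dual representation: with $\langle\rho^*(x)\xi,u\rangle=-\langle\xi,\rho(x)u\rangle$, $\langle\mu^*(x)\xi,u\rangle=-\langle\xi,\mu(x)u\rangle$, put $\rho^\star(x)\xi=\rho^*(\alpha(x))((\beta^{-2})^*\xi)$, $\mu^\star(x)\xi=\mu^*(\alpha(x))((\beta^{-2})^*\xi)$. Then $(V^*,(\beta^{-1})^*,\rho^\star-\mu^\star,-\mu^\star)$ is a representation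 of $A$. The semidirect product $A\ltimes_{(\rho^\star-\mu^\star,-\mu^\star)}V^*$ is the Hom-pre-Lie algebra on $A\oplus V^*$ with product $(x+\xi)\cdot(y+\eta)=x\cdot y+(\rho^\star-\mu^\star)(x)\eta-\mu^\star(y)\xi$ and twisting map $\alpha\oplus(\beta^{-1})^*$. Hom-$\mathfrak s$-matrix in a regular Hom-pre-Lie algebra $(B,\cdot,\gamma)$: for $r=\sum_i x_i\otimes y_i\in B\otimes B$ let $r^\sharp:B^*\to B$ be $\langle r^\sharp(\xi),\eta\rangle=\langle r,\xi\otimes\eta\rangle$, and $$[[r,r]]=\sum_{i,j}\Big(\gamma(x_i)\otimes[y_i,x_j]\otimes\gamma(y_j)-x_i\cdot x_j\otimes\gamma(y_j)\otimes\gamma(y_i)+\gamma(x_i)\otimes\gamma(x_j)\otimes y_i\cdot y_j\Big).$$ $r$ is a Hom-$\mathfrak s$-matrix if it is symmetric, $r^\sharp\circ(\gamma^{-1})^*=\gamma\circ r^\sharp$ and $[[r,r]]=0$. Hom-$\mathcal O$-operator on $(A,\cdot,\alpha)$ associated to $(V,\beta,\rho,\mu)$: a linear map $S:V\to A$ with $S\circ\beta=\alpha\circ S$ and $S(u)\cdot S(v)=S\big(\rho(S(\beta^{-1}(u)))v+\mu(S(\beta^{-1}(v)))u\big)$ for all $u,v\in V$. *)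

theory Defs
  imports
    "HOL-Analysis.Product_Vector"
    "HOL-Library.Function_Algebras"
begin

text \<open>
  A vector space is a linear subspace \<open>V\<close> (the carrier) of a type with a scalar multiplication
  \<open>s\<close> over a field \<open>'k\<close>. Carriers are needed because dual spaces are proper subsets of function
  types. Maps matter only on carriers, and equations between them are required on carriers only.
\<close>

definition fd_space :: "('k::field \<Rightarrow> 'a::ab_group_add \<Rightarrow> 'a) \<Rightarrow> 'a set \<Rightarrow> bool" where
  "fd_space s V \<longleftrightarrow> vector_space s \<and> (\<exists>X. finite X \<and> V = module.span s X)"

definition linear_on ::
  "('k::field \<Rightarrow> 'a::ab_group_add \<Rightarrow> 'a) \<Rightarrow> ('k \<Rightarrow> 'b::ab_group_add \<Rightarrow> 'b) \<Rightarrow> 'a set \<Rightarrow> 'b set \<Rightarrow> ('a \<Rightarrow> 'b) \<Rightarrow> bool"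
  where "linear_on s1 s2 V W f \<longleftrightarrow>
    (\<forall>x\<in>V. f x \<in> W) \<and> (\<forall>x\<in>V. \<forall>y\<in>V. f (x + y) = f x + f y) \<and> (\<forall>c. \<forall>x\<in>V. f (s1 c x) = s2 c (f x))"

text \<open>Curried, a bilinear map \<open>U \<times> V \<rightarrow> V\<close> is the same thing as a linear map \<open>U \<rightarrow> gl(V)\<close>.\<close>

definition bilinear_on ::
  "('k::field \<Rightarrow> 'a::ab_group_add \<Rightarrow> 'a) \<Rightarrow> ('k \<Rightarrow> 'b::ab_group_add \<Rightarrow> 'b) \<Rightarrow> ('k \<Rightarrow> 'c::ab_group_add \<Rightarrow> 'c)
    \<Rightarrow> 'a set \<Rightarrow> 'b set \<Rightarrow> 'c set \<Rightarrow> ('a \<Rightarrow> 'b \<Rightarrow> 'c) \<Rightarrow> bool"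
  where "bilinear_on s1 s2 s3 U V W f \<longleftrightarrow>
    (\<forall>x\<in>U. linear_on s2 s3 V W (f x)) \<and> (\<forall>y\<in>V. linear_on s1 s3 U W (\<lambda>x. f x y))"


subsection \<open>Hom-pre-Lie algebras, representations, Hom-O-operators\<close>

definition hom_pre_lie_algebra ::
  "('k::field \<Rightarrow> 'a::ab_group_add \<Rightarrow> 'a) \<Rightarrow> 'a set \<Rightarrow> ('a \<Rightarrow> 'a \<Rightarrow> 'a) \<Rightarrow> ('a \<Rightarrow> 'a) \<Rightarrow> bool"
  where "hom_pre_lie_algebra s A m \<alpha> \<longleftrightarrow>
    fd_space s A \<and> bilinear_on s s s A A A m \<and> linear_on s s A A \<alpha> \<and>
    (\<forall>x\<in>A. \<forall>y\<in>A. \<alpha> (m x y) = m (\<alpha> x) (\<alpha> y)) \<and>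
    (\<forall>x\<in>A. \<forall>y\<in>A. \<forall>z\<in>A.
      m (m x y) (\<alpha> z) - m (\<alpha> x) (m y z) = m (m y x) (\<alpha> z) - m (\<alpha> y) (m x z))"

definition regular_hom_pre_lie_algebra ::
  "('k::field \<Rightarrow> 'a::ab_group_add \<Rightarrow> 'a) \<Rightarrow> 'a set \<Rightarrow> ('a \<Rightarrow> 'a \<Rightarrow> 'a) \<Rightarrow> ('a \<Rightarrow> 'a) \<Rightarrow> bool"
  where "regular_hom_pre_lie_algebra s A m \<alpha> \<longleftrightarrow> hom_pre_lie_algebra s A m \<alpha> \<and> bij_betw \<alpha> A A"

definition commutator :: "('a \<Rightarrow> 'a \<Rightarrow> 'a::ab_group_add) \<Rightarrow> 'a \<Rightarrow> 'a \<Rightarrow> 'a" where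
  "commutator m x y = m x y - m y x"

definition hom_pre_lie_rep ::
  "('k::field \<Rightarrow> 'a::ab_group_add \<Rightarrow> 'a) \<Rightarrow> 'a set \<Rightarrow> ('a \<Rightarrow> 'a \<Rightarrow> 'a) \<Rightarrow> ('a \<Rightarrow> 'a) \<Rightarrow>
   ('k \<Rightarrow> 'v::ab_group_add \<Rightarrow> 'v) \<Rightarrow> 'v set \<Rightarrow> ('v \<Rightarrow> 'v) \<Rightarrow> ('a \<Rightarrow> 'v \<Rightarrow> 'v) \<Rightarrow> ('a \<Rightarrow> 'v \<Rightarrow> 'v) \<Rightarrow> bool"
  where "hom_pre_lie_rep sA A m \<alpha> sV V \<beta> \<rho> \<mu> \<longleftrightarrow>
    fd_space sV V \<and> linear_on sV sV V V \<beta> \<and>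
    bilinear_on sA sV sV A V V \<rho> \<and> bilinear_on sA sV sV A V V \<mu> \<and>
    (\<forall>x\<in>A. \<forall>v\<in>V. \<rho> (\<alpha> x) (\<beta> v) = \<beta> (\<rho> x v)) \<and>
    (\<forall>x\<in>A. \<forall>y\<in>A. \<forall>v\<in>V.
      \<rho> (commutator m x y) (\<beta> v) = \<rho> (\<alpha> x) (\<rho> y v) - \<rho> (\<alpha> y) (\<rho> x v)) \<and>
    (\<forall>x\<in>A. \<forall>v\<in>V. \<beta> (\<mu> x v) = \<mu> (\<alpha> x) (\<beta> v)) \<and>
    (\<forall>x\<in>A. \<forall>y\<in>A. \<forall>v\<in>V.
      \<mu> (\<alpha> y) (\<mu> x v) - \<mu> (m x y) (\<beta> v) = \<mu> (\<alpha> y) (\<rho> x v) - \<rho> (\<alpha> x) (\<mu> y v))"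

definition hom_O_operator ::
  "('k::field \<Rightarrow> 'a::ab_group_add \<Rightarrow> 'a) \<Rightarrow> 'a set \<Rightarrow> ('a \<Rightarrow> 'a \<Rightarrow> 'a) \<Rightarrow> ('a \<Rightarrow> 'a) \<Rightarrow>
   ('k \<Rightarrow> 'v::ab_group_add \<Rightarrow> 'v) \<Rightarrow> 'v set \<Rightarrow> ('v \<Rightarrow> 'v) \<Rightarrow> ('a \<Rightarrow> 'v \<Rightarrow> 'v) \<Rightarrow> ('a \<Rightarrow> 'v \<Rightarrow> 'v) \<Rightarrow>
   ('v \<Rightarrow> 'a) \<Rightarrow> bool"
  where "hom_O_operator sA A m \<alpha> sV V \<beta> \<rho> \<mu> S \<longleftrightarrow>
    linear_on sV sA V A S \<and> (\<forall>u\<in>V. S (\<beta> u) = \<alpha> (S u)) \<and>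
    (\<forall>u\<in>V. \<forall>v\<in>V.
      m (S u) (S v) = S (\<rho> (S (inv_into V \<beta> u)) v + \<mu> (S (inv_into V \<beta> v)) u))"


subsection \<open>Dual spaces and transposes\<close>

text \<open>
  Functionals on \<open>V\<close> are extended by \<open>0\<close> outside \<open>V\<close>, so that equality of functionals is equality
  of functions and the dual space is a subspace of the function type.
\<close>

definition fun_scale :: "'k::field \<Rightarrow> ('x \<Rightarrow> 'k) \<Rightarrow> 'x \<Rightarrow> 'k" where
  "fun_scale c f = (\<lambda>x. c * f x)"

definition dual :: "('k::field \<Rightarrow> 'a::ab_group_add \<Rightarrow> 'a) \<Rightarrow> 'a set \<Rightarrow> ('a \<Rightarrow> 'k) set" where
  "dual s V = {\<xi>. linear_on s (*) V UNIV \<xi> \<and> (\<forall>x. x \<notin> V \<longrightarrow> \<xi> x = 0)}"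

definition transp :: "'a set \<Rightarrow> ('a \<Rightarrow> 'b) \<Rightarrow> ('b \<Rightarrow> 'k::zero) \<Rightarrow> 'a \<Rightarrow> 'k" where
  "transp V f \<xi> = (\<lambda>v. if v \<in> V then \<xi> (f v) else 0)"

text \<open>\<open>\<langle>\<rho>\<^sup>*(x)\<xi>, u\<rangle> = -\<langle>\<xi>, \<rho>(x)u\<rangle>\<close>: unlike \<open>transp\<close>, this carries a sign.\<close>

definition dual_action :: "'v set \<Rightarrow> ('a \<Rightarrow> 'v \<Rightarrow> 'v) \<Rightarrow> 'a \<Rightarrow> ('v \<Rightarrow> 'k::ab_group_add) \<Rightarrow> 'v \<Rightarrow> 'k" where
  "dual_action V \<rho> x \<xi> = - transp V (\<rho> x) \<xi>"

definition star_action ::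
  "('a \<Rightarrow> 'a) \<Rightarrow> 'v set \<Rightarrow> ('v \<Rightarrow> 'v) \<Rightarrow> ('a \<Rightarrow> 'v \<Rightarrow> 'v) \<Rightarrow> 'a \<Rightarrow> ('v \<Rightarrow> 'k::ab_group_add) \<Rightarrow> 'v \<Rightarrow> 'k"
  where "star_action \<alpha> V \<beta> \<rho> x \<xi> =
    dual_action V \<rho> (\<alpha> x) (transp V (\<lambda>v. inv_into V \<beta> (inv_into V \<beta> v)) \<xi>)"


subsection \<open>The semidirect product with the dual representation\<close>

definition semidirect_mult ::
  "('a \<Rightarrow> 'a \<Rightarrow> 'a) \<Rightarrow> ('a \<Rightarrow> 'w \<Rightarrow> 'w) \<Rightarrow> ('a \<Rightarrow> 'w \<Rightarrow> 'w) \<Rightarrow> 'a \<times> 'w \<Rightarrow> 'a \<times> 'w \<Rightarrow> 'a \<times> 'w::ab_group_add"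
  where "semidirect_mult m \<rho> \<mu> p q =
    (m (fst p) (fst q), \<rho> (fst p) (snd q) + \<mu> (fst q) (snd p))"

definition sd_scale ::
  "('k::field \<Rightarrow> 'a::ab_group_add \<Rightarrow> 'a) \<Rightarrow> 'k \<Rightarrow> 'a \<times> ('v \<Rightarrow> 'k) \<Rightarrow> 'a \<times> ('v \<Rightarrow> 'k)"
  where "sd_scale sA = module_prod.scale sA fun_scale"

definition sd_carrier ::
  "'a set \<Rightarrow> ('k::field \<Rightarrow> 'v::ab_group_add \<Rightarrow> 'v) \<Rightarrow> 'v set \<Rightarrow> ('a \<times> ('v \<Rightarrow> 'k)) set"
  where "sd_carrier A sV V = A \<times> dual sV V"

definition sd_mult ::
  "('a \<Rightarrow> 'a \<Rightarrow> 'a) \<Rightarrow> ('a \<Rightarrow> 'a) \<Rightarrow> 'v set \<Rightarrow> ('v \<Rightarrow> 'v) \<Rightarrow> ('a \<Rightarrow> 'v \<Rightarrow> 'v) \<Rightarrow> ('a \<Rightarrow> 'v \<Rightarrow> 'v) \<Rightarrow>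
   'a \<times> ('v \<Rightarrow> 'k::ab_group_add) \<Rightarrow> 'a \<times> ('v \<Rightarrow> 'k) \<Rightarrow> 'a \<times> ('v \<Rightarrow> 'k)"
  where "sd_mult m \<alpha> V \<beta> \<rho> \<mu> =
    semidirect_mult m
      (\<lambda>x \<xi>. star_action \<alpha> V \<beta> \<rho> x \<xi> - star_action \<alpha> V \<beta> \<mu> x \<xi>)
      (\<lambda>x \<xi>. - star_action \<alpha> V \<beta> \<mu> x \<xi>)"

definition sd_twist ::
  "('a \<Rightarrow> 'a) \<Rightarrow> 'v set \<Rightarrow> ('v \<Rightarrow> 'v) \<Rightarrow> 'a \<times> ('v \<Rightarrow> 'k::zero) \<Rightarrow> 'a \<times> ('v \<Rightarrow> 'k)"
  where "sd_twist \<alpha> V \<beta> = map_prod \<alpha> (transp V (inv_into V \<beta>))"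

text \<open>
  The element \<open>\<xi> + u\<close> of \<open>A\<^sup>* \<oplus> V\<close>, regarded as the functional \<open>x + \<zeta> \<mapsto> \<langle>\<xi>, x\<rangle> + \<langle>\<zeta>, u\<rangle>\<close> on
  \<open>A \<oplus> V\<^sup>*\<close>.
\<close>

definition sd_functional ::
  "'a set \<Rightarrow> ('k::field \<Rightarrow> 'v::ab_group_add \<Rightarrow> 'v) \<Rightarrow> 'v set \<Rightarrow> ('a \<Rightarrow> 'k) \<Rightarrow> 'v \<Rightarrow> 'a \<times> ('v \<Rightarrow> 'k) \<Rightarrow> 'k"
  where "sd_functional A sV V \<xi> u =
    (\<lambda>p. if p \<in> sd_carrier A sV V then \<xi> (fst p) + (snd p) u else 0)"


subsection \<open>Tensors\<close>

text \<open>
  Over a field, \<open>x \<otimes> y \<mapsto> ((\<xi>, \<eta>) \<mapsto> \<xi>(x) \<eta>(y))\<close> embeds \<open>B \<otimes> B\<close> into the bilinear forms on the dual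
  of \<open>B\<close>; tensors are identified with their images, so that \<open>\<langle>r, \<xi> \<otimes> \<eta>\<rangle>\<close> is \<open>r \<xi> \<eta>\<close>. The same is done
  for three factors. Forms are extended by \<open>0\<close> outside the dual space.
\<close>

type_synonym ('b, 'k) tensor2 = "('b \<Rightarrow> 'k) \<Rightarrow> ('b \<Rightarrow> 'k) \<Rightarrow> 'k"
type_synonym ('b, 'k) tensor3 = "('b \<Rightarrow> 'k) \<Rightarrow> ('b \<Rightarrow> 'k) \<Rightarrow> ('b \<Rightarrow> 'k) \<Rightarrow> 'k"

definition pure2 ::
  "('k::field \<Rightarrow> 'b::ab_group_add \<Rightarrow> 'b) \<Rightarrow> 'b set \<Rightarrow> 'b \<Rightarrow> 'b \<Rightarrow> ('b, 'k) tensor2"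
  where "pure2 s B x y =
    (\<lambda>\<xi> \<eta>. if \<xi> \<in> dual s B \<and> \<eta> \<in> dual s B then \<xi> x * \<eta> y else 0)"

definition pure3 ::
  "('k::field \<Rightarrow> 'b::ab_group_add \<Rightarrow> 'b) \<Rightarrow> 'b set \<Rightarrow> 'b \<Rightarrow> 'b \<Rightarrow> 'b \<Rightarrow> ('b, 'k) tensor3"
  where "pure3 s B x y z =
    (\<lambda>\<xi> \<eta> \<zeta>. if \<xi> \<in> dual s B \<and> \<eta> \<in> dual s B \<and> \<zeta> \<in> dual s B then \<xi> x * \<eta> y * \<zeta> z else 0)"

definition decomposes ::
  "('k::field \<Rightarrow> 'b::ab_group_add \<Rightarrow> 'b) \<Rightarrow> 'b set \<Rightarrow> ('b, 'k) tensor2 \<Rightarrow> ('b \<times> 'b) list \<Rightarrow> bool"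
  where "decomposes s B r xs \<longleftrightarrow> set xs \<subseteq> B \<times> B \<and> r = (\<Sum>(x, y)\<leftarrow>xs. pure2 s B x y)"

definition tensor_square ::
  "('k::field \<Rightarrow> 'b::ab_group_add \<Rightarrow> 'b) \<Rightarrow> 'b set \<Rightarrow> ('b, 'k) tensor2 set"
  where "tensor_square s B = {r. \<exists>xs. decomposes s B r xs}"

definition tensor_flip :: "('b, 'k) tensor2 \<Rightarrow> ('b, 'k) tensor2" where
  "tensor_flip r = (\<lambda>\<xi> \<eta>. r \<eta> \<xi>)"

definition sharp ::
  "('k::field \<Rightarrow> 'b::ab_group_add \<Rightarrow> 'b) \<Rightarrow> 'b set \<Rightarrow> ('b, 'k) tensor2 \<Rightarrow> ('b \<Rightarrow> 'k) \<Rightarrow> 'b"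
  where "sharp s B r \<xi> = (THE x. x \<in> B \<and> (\<forall>\<eta>\<in>dual s B. \<eta> x = r \<xi> \<eta>))"


subsection \<open>Hom-s-matrices\<close>

definition s_bracket_sum ::
  "('k::field \<Rightarrow> 'b::ab_group_add \<Rightarrow> 'b) \<Rightarrow> 'b set \<Rightarrow> ('b \<Rightarrow> 'b \<Rightarrow> 'b) \<Rightarrow> ('b \<Rightarrow> 'b) \<Rightarrow>
   ('b \<times> 'b) list \<Rightarrow> ('b, 'k) tensor3"
  where "s_bracket_sum s B m \<gamma> xs =
    (\<Sum>(x, y)\<leftarrow>xs. \<Sum>(x', y')\<leftarrow>xs.
       pure3 s B (\<gamma> x) (commutator m y x') (\<gamma> y')
     - pure3 s B (m x x') (\<gamma> y') (\<gamma> y)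
     + pure3 s B (\<gamma> x) (\<gamma> x') (m y y'))"

text \<open>
  The choice of a decomposition is immaterial by \<open>s_bracket_eq\<close> below.
\<close>

definition s_bracket ::
  "('k::field \<Rightarrow> 'b::ab_group_add \<Rightarrow> 'b) \<Rightarrow> 'b set \<Rightarrow> ('b \<Rightarrow> 'b \<Rightarrow> 'b) \<Rightarrow> ('b \<Rightarrow> 'b) \<Rightarrow>
   ('b, 'k) tensor2 \<Rightarrow> ('b, 'k) tensor3"
  where "s_bracket s B m \<gamma> r = s_bracket_sum s B m \<gamma> (SOME xs. decomposes s B r xs)"

definition hom_s_matrix ::
  "('k::field \<Rightarrow> 'b::ab_group_add \<Rightarrow> 'b) \<Rightarrow> 'b set \<Rightarrow> ('b \<Rightarrow> 'b \<Rightarrow> 'b) \<Rightarrow> ('b \<Rightarrow> 'b) \<Rightarrow>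
   ('b, 'k) tensor2 \<Rightarrow> bool"
  where "hom_s_matrix s B m \<gamma> r \<longleftrightarrow>
    r \<in> tensor_square s B \<and> tensor_flip r = r \<and>
    (\<forall>\<xi>\<in>dual s B. sharp s B r (transp B (inv_into B \<gamma>) \<xi>) = \<gamma> (sharp s B r \<xi>)) \<and>
    s_bracket s B m \<gamma> r = 0"

lemma fd_space_dual_basis:
  assumes "fd_space s V"
  obtains Bs where "finite Bs" "Bs \<subseteq> V" "\<And>b. (\<lambda>v. module.representation s Bs v b) \<in> dual s V"
    "\<And>v. v \<in> V \<Longrightarrow> v = (\<Sum>b\<in>Bs. s (module.representation s Bs v b) b)"
proof -
  from assms interpret vector_space s by (simp add: fd_space_def)
  from assms obtain X where X: "finite X" "V = span X" by (auto simp: fd_space_def)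
  obtain Bs where Bs: "Bs \<subseteq> X" "independent Bs" "X \<subseteq> span Bs"
    using maximal_independent_subset by blast
  have fin: "finite Bs" using Bs(1) X(1) finite_subset by blast
  have V: "V = span Bs"
    using span_mono[OF Bs(1)] span_minimal[OF Bs(3) subspace_span] X(2) by blast
  have "(\<lambda>v. representation Bs v b) \<in> dual s V" for b
    using Bs(2) unfolding V dual_def linear_on_def
    by (auto simp: representation_add representation_scale) (simp add: representation_def)
  moreover have "v = (\<Sum>b\<in>Bs. s (representation Bs v b) b)" if "v \<in> V" for v
    using sum_representation_eq[OF Bs(2), of v Bs] that V fin by simp
  ultimately show thesis using that[of Bs] fin V span_superset by blast
qed

lemma fd_space_subspace: "fd_space s V \<Longrightarrow> vector_space s \<and> module.subspace s V"
  by (auto simp: fd_space_def module.subspace_span vector_space_def module_def)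

lemma linear_on_sum:
  assumes "vector_space s1" "module.subspace s1 V" "vector_space s2" "linear_on s1 s2 V W f" "\<And>i. i \<in> I \<Longrightarrow> g i \<in> V"
  shows "f (\<Sum>i\<in>I. s1 (c i) (g i)) = (\<Sum>i\<in>I. s2 (c i) (f (g i)))"
proof -
  interpret v1: vector_space s1 by fact
  interpret v2: vector_space s2 by fact
  have f0: "f 0 = 0"
  proof -
    have "f (s1 0 0) = s2 0 (f 0)"
      using assms(4) v1.subspace_0[OF assms(2)] unfolding linear_on_def by blast
    then show ?thesis by simp
  qed
  have "(\<Sum>i\<in>I. s1 (c i) (g i)) \<in> V \<and> f (\<Sum>i\<in>I. s1 (c i) (g i)) = (\<Sum>i\<in>I. s2 (c i) (f (g i)))"
    using assms(5)
  proof (induction I rule: infinite_finite_induct)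
    case (insert i I)
    have "s1 (c i) (g i) \<in> V"
      using insert.prems assms(2) v1.subspace_scale by blast
    then show ?case
      using insert assms(4) v1.subspace_add[OF assms(2)] by (simp add: linear_on_def)
  qed (use f0 v1.subspace_0[OF assms(2)] in auto)
  then show ?thesis by simp
qed

lemma vector_space_times: "vector_space ((*) :: 'k::field \<Rightarrow> 'k \<Rightarrow> 'k)"
  by unfold_locales (auto simp: algebra_simps)

lemma sum_list_apply2: "(\<Sum>p\<leftarrow>xs. f p) \<xi> \<eta> = (\<Sum>p\<leftarrow>xs. f p \<xi> \<eta>)"
  for f :: "_ \<Rightarrow> _ \<Rightarrow> _ \<Rightarrow> 'k::ab_group_add"
  by (induction xs) auto

lemma sum_list_apply3: "(\<Sum>p\<leftarrow>xs. f p) \<xi> \<eta> \<zeta> = (\<Sum>p\<leftarrow>xs. f p \<xi> \<eta> \<zeta>)"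
  for f :: "_ \<Rightarrow> _ \<Rightarrow> _ \<Rightarrow> _ \<Rightarrow> 'k::ab_group_add"
  by (induction xs) auto

lemma sum_list_swap: "(\<Sum>p\<leftarrow>xs. \<Sum>q\<leftarrow>ys. f p q) = (\<Sum>q\<leftarrow>ys. \<Sum>p\<leftarrow>xs. f p q)"
  for f :: "_ \<Rightarrow> _ \<Rightarrow> 'k::ab_group_add"
  by (induction xs) (auto simp: sum_list_addf)

lemma decomposes_bilinear_sum_eq:
  fixes s :: "'k::field \<Rightarrow> 'b::ab_group_add \<Rightarrow> 'b"
  assumes B: "fd_space s B" and F: "bilinear_on s s (*) B B UNIV F"
    and xs: "decomposes s B r xs" and ys: "decomposes s B r ys"
  shows "(\<Sum>(x, y)\<leftarrow>xs. F x y) = (\<Sum>(x, y)\<leftarrow>ys. F x y)"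
proof -
  from fd_space_dual_basis[OF B] obtain Bs where Bs: "finite Bs" "Bs \<subseteq> B"
    and dual: "\<And>b. (\<lambda>v. module.representation s Bs v b) \<in> dual s B"
    and rep: "\<And>v. v \<in> B \<Longrightarrow> v = (\<Sum>b\<in>Bs. s (module.representation s Bs v b) b)"
    by blast
  define R where "R b v = module.representation s Bs v b" for b v
  have dual: "R b \<in> dual s B" for b using dual unfolding R_def by simp
  have rep: "v = (\<Sum>b\<in>Bs. s (R b v) b)" if "v \<in> B" for v using rep[OF that] unfolding R_def .
  have vs: "vector_space s" "module.subspace s B" using fd_space_subspace[OF B] by auto
  have expand: "F x y = (\<Sum>b\<in>Bs. \<Sum>c\<in>Bs. R b x * R c y * F b c)" if "x \<in> B" "y \<in> B" for x y
  proof -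
    have "F x y = F (\<Sum>b\<in>Bs. s (R b x) b) y" using rep[OF \<open>x \<in> B\<close>] by simp
    also have "\<dots> = (\<Sum>b\<in>Bs. R b x * F b y)"
      by (rule linear_on_sum[OF vs vector_space_times, of UNIV "\<lambda>x. F x y" Bs "\<lambda>b. b"])
        (use F that Bs(2) in \<open>auto simp: bilinear_on_def\<close>)
    also have "\<dots> = (\<Sum>b\<in>Bs. R b x * F b (\<Sum>c\<in>Bs. s (R c y) c))" using rep[OF \<open>y \<in> B\<close>] by simp
    also have "\<dots> = (\<Sum>b\<in>Bs. R b x * (\<Sum>c\<in>Bs. R c y * F b c))"
    proof (rule sum.cong[OF refl])
      fix b assume "b \<in> Bs"
      then have "F b (\<Sum>c\<in>Bs. s (R c y) c) = (\<Sum>c\<in>Bs. R c y * F b c)"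
        by (intro linear_on_sum[OF vs vector_space_times, of UNIV "F b" Bs "\<lambda>b. b"])
          (use F Bs(2) in \<open>auto simp: bilinear_on_def\<close>)
      then show "R b x * F b (\<Sum>c\<in>Bs. s (R c y) c) = R b x * (\<Sum>c\<in>Bs. R c y * F b c)" by simp
    qed
    finally show ?thesis by (simp add: sum_distrib_left mult.assoc)
  qed
  have main: "(\<Sum>(x, y)\<leftarrow>zs. F x y) = (\<Sum>b\<in>Bs. \<Sum>c\<in>Bs. r (R b) (R c) * F b c)"
    if zs: "decomposes s B r zs" for zs
  proof -
    have r: "r (R b) (R c) = (\<Sum>(x, y)\<leftarrow>zs. R b x * R c y)" for b c
    proof -
      have "r (R b) (R c) = (\<Sum>(x, y)\<leftarrow>zs. pure2 s B x y) (R b) (R c)"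
        using zs by (simp add: decomposes_def)
      then show ?thesis
        by (simp add: sum_list_apply2 case_prod_unfold pure2_def dual)
    qed
    have "set zs \<subseteq> B \<times> B" using zs by (simp add: decomposes_def)
    then have "(\<Sum>(x, y)\<leftarrow>zs. F x y)
        = (\<Sum>b\<in>Bs. \<Sum>c\<in>Bs. (\<Sum>(x, y)\<leftarrow>zs. R b x * R c y) * F b c)"
    proof (induction zs)
      case (Cons p zs)
      then show ?case
        by (cases p) (auto simp: expand algebra_simps sum.distrib)
    qed simp
    then show ?thesis by (simp add: r)
  qed
  show ?thesis using main[OF xs] main[OF ys] by simp
qed

lemma s_bracket_sum_cong:
  assumes B: "fd_space s B" and m: "bilinear_on s s s B B B m" and g: "linear_on s s B B \<gamma>"
    and xs: "decomposes s B r xs" and ys: "decomposes s B r ys"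
  shows "s_bracket_sum s B m \<gamma> xs = s_bracket_sum s B m \<gamma> ys"
proof (intro ext)
  fix \<xi> \<eta> \<zeta>
  interpret vector_space s using B by (simp add: fd_space_def)
  define P where "P x y x' y' = (pure3 s B (\<gamma> x) (commutator m y x') (\<gamma> y')
     - pure3 s B (m x x') (\<gamma> y') (\<gamma> y)
     + pure3 s B (\<gamma> x) (\<gamma> x') (m y y')) \<xi> \<eta> \<zeta>" for x y x' y'
  have sub: "subspace B" using fd_space_subspace[OF B] by simp
  have cl: "x + y \<in> B" "x - y \<in> B" "s c x \<in> B" if "x \<in> B" "y \<in> B" for x y c
    using sub that subspace_add subspace_diff subspace_scale by auto
  have mg: "m x y \<in> B" "\<gamma> x \<in> B" "m (x + z) y = m x y + m z y" "m x (y + z) = m x y + m x z"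
     "m (s c x) y = s c (m x y)" "m x (s c y) = s c (m x y)"
     "\<gamma> (x + y) = \<gamma> x + \<gamma> y" "\<gamma> (s c x) = s c (\<gamma> x)"
    if "x \<in> B" "y \<in> B" "z \<in> B" for x y z c
    using m g that unfolding bilinear_on_def linear_on_def by blast+
  have d: "\<phi> (x + y) = \<phi> x + \<phi> y" "\<phi> (s c x) = c * \<phi> x" "\<phi> (x - y) = \<phi> x - \<phi> y"
    if "\<phi> \<in> dual s B" "x \<in> B" "y \<in> B" for \<phi> x y c
  proof -
    show 1: "\<phi> (x + y) = \<phi> x + \<phi> y" "\<phi> (s c x) = c * \<phi> x"
      using that unfolding dual_def linear_on_def by blast+
    have "\<phi> ((x - y) + y) = \<phi> (x - y) + \<phi> y"
      using that cl unfolding dual_def linear_on_def by blast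
    then show "\<phi> (x - y) = \<phi> x - \<phi> y" by (simp add: algebra_simps)
  qed
  have lin1: "bilinear_on s s (*) B B UNIV (\<lambda>x y. P x y x' y')" if "x' \<in> B" "y' \<in> B" for x' y'
    unfolding bilinear_on_def linear_on_def P_def using that
    by (auto simp: pure3_def commutator_def mg d cl algebra_simps)
  have lin2: "bilinear_on s s (*) B B UNIV (\<lambda>x' y'. P x y x' y')" if "x \<in> B" "y \<in> B" for x y
    unfolding bilinear_on_def linear_on_def P_def using that
    by (auto simp: pure3_def commutator_def mg d cl algebra_simps)
  have eq: "s_bracket_sum s B m \<gamma> zs \<xi> \<eta> \<zeta> = (\<Sum>(x, y)\<leftarrow>zs. \<Sum>(x', y')\<leftarrow>zs. P x y x' y')" for zs
    unfolding s_bracket_sum_def P_def by (simp add: sum_list_apply3 case_prod_unfold)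
  have sub_xs: "set xs \<subseteq> B \<times> B" "set ys \<subseteq> B \<times> B" using xs ys by (auto simp: decomposes_def)
  have "(\<Sum>(x, y)\<leftarrow>xs. \<Sum>(x', y')\<leftarrow>xs. P x y x' y') = (\<Sum>(x, y)\<leftarrow>xs. \<Sum>(x', y')\<leftarrow>ys. P x y x' y')"
    by (rule arg_cong[where f = sum_list], rule map_cong[OF refl])
      (use sub_xs decomposes_bilinear_sum_eq[OF B lin2 xs ys] in auto)
  also have "\<dots> = (\<Sum>(x', y')\<leftarrow>ys. \<Sum>(x, y)\<leftarrow>xs. P x y x' y')"
    by (simp add: case_prod_unfold, rule sum_list_swap)
  also have "\<dots> = (\<Sum>(x', y')\<leftarrow>ys. \<Sum>(x, y)\<leftarrow>ys. P x y x' y')"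
    by (rule arg_cong[where f = sum_list], rule map_cong[OF refl])
      (use sub_xs decomposes_bilinear_sum_eq[OF B lin1 xs ys] in auto)
  also have "\<dots> = (\<Sum>(x, y)\<leftarrow>ys. \<Sum>(x', y')\<leftarrow>ys. P x y x' y')"
    by (simp add: case_prod_unfold, rule sum_list_swap)
  finally show "s_bracket_sum s B m \<gamma> xs \<xi> \<eta> \<zeta> = s_bracket_sum s B m \<gamma> ys \<xi> \<eta> \<zeta>"
    unfolding eq .
qed

lemma s_bracket_eq:
  assumes "fd_space s B" "bilinear_on s s s B B B m" "linear_on s s B B \<gamma>" "decomposes s B r xs"
  shows "s_bracket s B m \<gamma> r = s_bracket_sum s B m \<gamma> xs"
proof -
  have "decomposes s B r (SOME xs. decomposes s B r xs)"
    using assms(4) by (rule someI)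
  then show ?thesis
    unfolding s_bracket_def using s_bracket_sum_cong assms by blast
qed

text \<open>The description in \<open>sharp\<close> is proper: \<open>r\<^sup>\<sharp>(\<xi>) = \<Sum>\<^sub>i \<xi>(x\<^sub>i) y\<^sub>i\<close>.\<close>

lemma dual_sum_list:
  assumes "vector_space s" "module.subspace s V" "\<xi> \<in> dual s V" "\<And>p. p \<in> set ps \<Longrightarrow> g p \<in> V"
  shows "(\<Sum>p\<leftarrow>ps. s (c p) (g p)) \<in> V \<and> \<xi> (\<Sum>p\<leftarrow>ps. s (c p) (g p)) = (\<Sum>p\<leftarrow>ps. c p * \<xi> (g p))"
proof -
  interpret vector_space s by fact
  have xi: "\<xi> (x + y) = \<xi> x + \<xi> y" "\<xi> (s k x) = k * \<xi> x" if "x \<in> V" "y \<in> V" for x y k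
    using assms(3) that unfolding dual_def linear_on_def by blast+
  have "\<xi> 0 = 0" using xi(2)[of 0 0 0] subspace_0[OF assms(2)] by simp
  then show ?thesis
    using assms(4) subspace_0[OF assms(2)]
    by (induction ps) (auto simp: xi subspace_add[OF assms(2)] subspace_scale[OF assms(2)])
qed

lemma sharp_eq:
  assumes B: "fd_space s B" and r: "decomposes s B r xs" and \<xi>: "\<xi> \<in> dual s B"
  shows "sharp s B r \<xi> = (\<Sum>(x, y)\<leftarrow>xs. s (\<xi> x) y)"
  unfolding sharp_def
proof (rule the_equality)
  have vs: "vector_space s" "module.subspace s B" using fd_space_subspace[OF B] by auto
  have xs: "set xs \<subseteq> B \<times> B" using r by (simp add: decomposes_def)
  have r_eq: "r \<xi> \<eta> = (\<Sum>(x, y)\<leftarrow>xs. \<xi> x * \<eta> y)" if "\<eta> \<in> dual s B" for \<eta>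
  proof -
    have "r \<xi> \<eta> = (\<Sum>(x, y)\<leftarrow>xs. pure2 s B x y) \<xi> \<eta>" using r by (simp add: decomposes_def)
    then show ?thesis using that \<xi> by (simp add: sum_list_apply2 case_prod_unfold pure2_def)
  qed
  define w where "w = (\<Sum>(x, y)\<leftarrow>xs. s (\<xi> x) y)"
  have snd_B: "snd p \<in> B" if "p \<in> set xs" for p using xs that by auto
  have w': "w \<in> B \<and> \<eta> w = r \<xi> \<eta>" if \<eta>: "\<eta> \<in> dual s B" for \<eta>
    using dual_sum_list[OF vs \<eta>, of xs snd "\<lambda>p. \<xi> (fst p)", OF snd_B]
    unfolding w_def r_eq[OF \<eta>] case_prod_unfold .
  have w: "w \<in> B" "\<forall>\<eta>\<in>dual s B. \<eta> w = r \<xi> \<eta>" by (rule conjunct1[OF w'[OF \<xi>]], rule ballI, rule conjunct2[OF w'])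
  show "(\<Sum>(x, y)\<leftarrow>xs. s (\<xi> x) y) \<in> B
      \<and> (\<forall>\<eta>\<in>dual s B. \<eta> (\<Sum>(x, y)\<leftarrow>xs. s (\<xi> x) y) = r \<xi> \<eta>)"
    using conjI[OF w] unfolding w_def .
  fix z assume z: "z \<in> B \<and> (\<forall>\<eta>\<in>dual s B. \<eta> z = r \<xi> \<eta>)"
  from fd_space_dual_basis[OF B] obtain Bs where Bs: "finite Bs" "Bs \<subseteq> B"
    and dual: "\<And>b. (\<lambda>v. module.representation s Bs v b) \<in> dual s B"
    and rep: "\<And>v. v \<in> B \<Longrightarrow> v = (\<Sum>b\<in>Bs. s (module.representation s Bs v b) b)"
    by blast
  define R where "R b v = module.representation s Bs v b" for b v
  have dual: "R b \<in> dual s B" for b using dual unfolding R_def .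
  have rep: "v = (\<Sum>b\<in>Bs. s (R b v) b)" if "v \<in> B" for v using rep[OF that] unfolding R_def .
  have R_eq: "R b z = R b w" for b
    using bspec[OF w(2) dual[of b]] bspec[OF conjunct2[OF z] dual[of b]] by (simp only:)
  have "z = (\<Sum>b\<in>Bs. s (R b z) b)" by (rule rep[OF conjunct1[OF z]])
  also have "\<dots> = (\<Sum>b\<in>Bs. s (R b w) b)" unfolding R_eq ..
  also have "\<dots> = w" using rep[OF w(1)] by (rule sym)
  finally show "z = (\<Sum>(x, y)\<leftarrow>xs. s (\<xi> x) y)" unfolding w_def .
qed

text \<open>
  \<open>\<xi> + u \<mapsto> sd_functional \<xi> u\<close> maps onto the dual of \<open>A \<oplus> V\<^sup>*\<close>, and the values prescribed for
  \<open>T\<close>-bar determine exactly one tensor.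
\<close>

lemma sd_scale_apply:
  assumes "vector_space sA"
  shows "sd_scale sA c p = (sA c (fst p), fun_scale c (snd p))"
proof -
  interpret vector_space sA by fact
  have "vector_space (fun_scale :: 'a \<Rightarrow> ('c \<Rightarrow> 'a) \<Rightarrow> 'c \<Rightarrow> 'a)"
    by unfold_locales (auto simp: fun_scale_def algebra_simps)
  then have "module_prod sA (fun_scale :: 'a \<Rightarrow> ('c \<Rightarrow> 'a) \<Rightarrow> 'c \<Rightarrow> 'a)"
    unfolding module_prod_def module_pair_def
    using module_axioms by (simp add: vector_space_def module_def)
  then show ?thesis unfolding sd_scale_def by (rule module_prod.scale_def)
qed

lemma fun_scale_simps: "fun_scale c \<xi> x = c * \<xi> x" "fun_scale c 0 = 0" "fun_scale 0 \<xi> = 0"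
  by (auto simp: fun_scale_def)

lemma dual_closed:
  "\<xi> \<in> dual s V \<Longrightarrow> \<eta> \<in> dual s V \<Longrightarrow> \<xi> + \<eta> \<in> dual s V"
  "\<xi> \<in> dual s V \<Longrightarrow> fun_scale c \<xi> \<in> dual s V"
  by (auto simp: dual_def linear_on_def fun_scale_def algebra_simps)

lemma sd_functional_dual:
  assumes A: "vector_space sA" "module.subspace sA A" and "\<xi> \<in> dual sA A" "u \<in> V"
  shows "sd_functional A sV V \<xi> u \<in> dual (sd_scale sA) (sd_carrier A sV V)"
proof -
  interpret vector_space sA by fact
  have "\<xi> (x + y) = \<xi> x + \<xi> y" "\<xi> (sA c x) = c * \<xi> x" if "x \<in> A" "y \<in> A" for x y c
    using assms(3) that unfolding dual_def linear_on_def by blast+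
  then show ?thesis
    using subspace_add[OF A(2)] subspace_scale[OF A(2)]
    unfolding dual_def[of "sd_scale sA"] linear_on_def sd_functional_def sd_carrier_def
    by (auto simp: sd_scale_apply[OF A(1)] dual_closed fun_scale_simps algebra_simps)
qed

lemma sd_functional_surj:
  assumes A: "vector_space sA" "module.subspace sA A" and V: "fd_space sV V"
    and \<phi>: "\<phi> \<in> dual (sd_scale sA) (sd_carrier A sV V)"
  obtains \<xi> u where "\<xi> \<in> dual sA A" "u \<in> V" "\<phi> = sd_functional A sV V \<xi> u"
proof -
  interpret vector_space sA by fact
  interpret V: vector_space sV using V by (simp add: fd_space_def)
  have subV: "V.subspace V" using fd_space_subspace[OF V] by simp
  from fd_space_dual_basis[OF V] obtain Bs where Bs: "finite Bs" "Bs \<subseteq> V"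
    and dual: "\<And>b. (\<lambda>v. V.representation Bs v b) \<in> dual sV V"
    and rep: "\<And>v. v \<in> V \<Longrightarrow> v = (\<Sum>b\<in>Bs. sV (V.representation Bs v b) b)"
    by blast
  define R where "R b v = V.representation Bs v b" for b v
  have dual: "R b \<in> dual sV V" for b using dual unfolding R_def by simp
  have zero: "0 \<in> dual sV V" by (auto simp: dual_def linear_on_def)
  have phi: "\<phi> (p + q) = \<phi> p + \<phi> q" "\<phi> (sA c (fst p), fun_scale c (snd p)) = c * \<phi> p"
    if "p \<in> sd_carrier A sV V" "q \<in> sd_carrier A sV V" for p q c
    using \<phi> that unfolding dual_def[of "sd_scale sA"] linear_on_def sd_scale_apply[OF A(1)] by blast+
  have A0: "0 \<in> A" by (rule subspace_0[OF A(2)])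
  define \<xi> where "\<xi> x = (if x \<in> A then \<phi> (x, 0) else 0)" for x
  define u where "u = (\<Sum>b\<in>Bs. sV (\<phi> (0, R b)) b)"
  have "\<xi> \<in> dual sA A"
  proof -
    have "\<phi> (x + y, 0) = \<phi> (x, 0) + \<phi> (y, 0)" "\<phi> (sA c x, 0) = c * \<phi> (x, 0)"
      if "x \<in> A" "y \<in> A" for x y c
      using phi(1)[of "(x, 0)" "(y, 0)"] phi(2)[of "(x, 0)" "(x, 0)" c] zero that
      by (simp_all add: sd_carrier_def fun_scale_simps)
    then show ?thesis
      using subspace_add[OF A(2)] subspace_scale[OF A(2)]
      by (simp add: dual_def[of sA] linear_on_def \<xi>_def)
  qed
  moreover have uV: "u \<in> V"
    unfolding u_def using Bs(2) by (auto intro!: V.subspace_sum subV V.subspace_scale)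
  moreover have "\<phi> = sd_functional A sV V \<xi> u"
  proof
    fix p
    show "\<phi> p = sd_functional A sV V \<xi> u p"
    proof (cases "p \<in> sd_carrier A sV V")
      case False
      then show ?thesis using \<phi> by (cases p) (simp add: sd_functional_def dual_def[of "sd_scale sA"])
    next
      case True
      obtain x \<zeta> where p: "p = (x, \<zeta>)" by (cases p)
      have x: "x \<in> A" and \<zeta>: "\<zeta> \<in> dual sV V" using True p by (auto simp: sd_carrier_def)
      have \<zeta>_lin: "linear_on sV (*) V UNIV \<zeta>" using \<zeta> by (simp add: dual_def)
      have \<zeta>_sum: "\<zeta> (\<Sum>b\<in>Bs. sV (c b) b) = (\<Sum>b\<in>Bs. c b * \<zeta> b)" for c
        by (rule linear_on_sum[OF V.vector_space_axioms subV vector_space_times \<zeta>_lin])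
          (use Bs(2) in auto)
      have \<zeta>_exp: "\<zeta> = (\<Sum>b\<in>Bs. fun_scale (\<zeta> b) (R b))"
      proof
        fix v
        have ap: "(\<Sum>b\<in>Bs. fun_scale (\<zeta> b) (R b)) v = (\<Sum>b\<in>Bs. \<zeta> b * R b v)"
          using Bs(1) by (induction Bs rule: finite_induct) (auto simp: fun_scale_def)
        show "\<zeta> v = (\<Sum>b\<in>Bs. fun_scale (\<zeta> b) (R b)) v"
        proof (cases "v \<in> V")
          case True
          then show ?thesis
            using \<zeta>_sum[of "\<lambda>b. R b v"] rep[OF True]
            unfolding ap mult.commute[of "\<zeta> _"] R_def by metis
        next
          case False
          then have "\<zeta> v = 0" "\<And>b. R b v = 0" using \<zeta> dual by (auto simp: dual_def)
          then show ?thesis unfolding ap by simp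
        qed
      qed
      define S where "S C = (\<Sum>b\<in>C. fun_scale (\<zeta> b) (R b))" for C
      have S_simps: "S {} = 0" "S (insert b C) = fun_scale (\<zeta> b) (R b) + S C"
        if "finite C" "b \<notin> C" for b C
        unfolding S_def by (rule sum.empty, rule sum.insert[OF that])
      have "S C \<in> dual sV V \<and> \<phi> (0, S C) = (\<Sum>b\<in>C. \<zeta> b * \<phi> (0, R b))"
        if "finite C" for C using that
      proof (induction C rule: finite_induct)
        case empty
        then show ?case using zero A0 phi(2)[of "(0, 0)" "(0, 0)" 0]
          by (simp add: sd_carrier_def fun_scale_simps(2,3) S_def flip: zero_fun_def)
      next
        case (insert b C)
        have "fun_scale (\<zeta> b) (R b) \<in> dual sV V" using dual dual_closed by blast
        then show ?case using insert A0 dual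
            phi(1)[of "(0, fun_scale (\<zeta> b) (R b))" "(0, S C)"]
            phi(2)[of "(0, R b)" "(0, R b)" "\<zeta> b"]
          by (subst (1 2) S_simps(2)[OF insert.hyps]) (simp add: sd_carrier_def dual_closed)
      qed
      then have "\<phi> (0, \<zeta>) = (\<Sum>b\<in>Bs. \<zeta> b * \<phi> (0, R b))"
        using Bs(1) \<zeta>_exp unfolding S_def by metis
      also have "\<dots> = \<zeta> u" unfolding u_def by (simp add: \<zeta>_sum mult.commute)
      finally have "\<phi> (0, \<zeta>) = \<zeta> u" .
      then show ?thesis
        using phi(1)[of "(x, 0)" "(0, \<zeta>)"] x \<zeta> zero A0 True p
        by (simp add: sd_functional_def \<xi>_def sd_carrier_def)
    qed
  qed
  ultimately show thesis using that by blast
qed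

lemma bar_tensor_ex1:
  assumes A: "fd_space sA A" and V: "fd_space sV V" and T: "linear_on sV sA V A T"
  shows "\<exists>!t. t \<in> tensor_square (sd_scale sA) (sd_carrier A sV V) \<and>
    (\<forall>\<xi>\<in>dual sA A. \<forall>\<eta>\<in>dual sA A. \<forall>u\<in>V. \<forall>v\<in>V.
      t (sd_functional A sV V \<xi> u) (sd_functional A sV V \<eta> v) = \<eta> (T u))"
    (is "\<exists>!t. t \<in> ?TS \<and> ?P t")
proof -
  interpret A: vector_space sA using A by (simp add: fd_space_def)
  interpret V: vector_space sV using V by (simp add: fd_space_def)
  have sub: "A.subspace A" "V.subspace V" using fd_space_subspace A V by blast+
  from fd_space_dual_basis[OF V] obtain Bs where Bs: "finite Bs" "Bs \<subseteq> V"
    and dual: "\<And>b. (\<lambda>v. V.representation Bs v b) \<in> dual sV V"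
    and rep: "\<And>v. v \<in> V \<Longrightarrow> v = (\<Sum>b\<in>Bs. sV (V.representation Bs v b) b)"
    by blast
  define R where "R b v = V.representation Bs v b" for b v
  have dual: "R b \<in> dual sV V" for b using dual unfolding R_def by simp
  obtain bs where bs: "distinct bs" "set bs = Bs" using Bs(1) finite_distinct_list by blast
  have zero: "0 \<in> dual sV V" "0 \<in> A" using A.subspace_0 sub by (auto simp: dual_def linear_on_def)
  have TA: "T v \<in> A" if "v \<in> V" for v using T that by (simp add: linear_on_def)
  let ?s = "sd_scale sA" let ?B = "sd_carrier A sV V"
  let ?xs = "map (\<lambda>b. ((0, R b), (T b, 0))) bs"
  define t where "t = (\<Sum>(x, y)\<leftarrow>?xs. pure2 ?s ?B x y)"
  have "t \<in> ?TS"
  proof -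
    have "set ?xs \<subseteq> ?B \<times> ?B" using zero dual TA bs(2) Bs(2) by (auto simp: sd_carrier_def)
    then show ?thesis unfolding tensor_square_def decomposes_def t_def by blast
  qed
  moreover have "?P t"
  proof (intro ballI)
    fix \<xi> \<eta> u v assume *: "\<xi> \<in> dual sA A" "\<eta> \<in> dual sA A" "u \<in> V" "v \<in> V"
    let ?f = "sd_functional A sV V \<xi> u" let ?g = "sd_functional A sV V \<eta> v"
    have fg: "?f \<in> dual ?s ?B" "?g \<in> dual ?s ?B"
      using * sub A.vector_space_axioms by (auto intro: sd_functional_dual)
    have \<eta>_lin: "linear_on sA (*) A UNIV \<eta>" using * by (simp add: dual_def)
    have xi0: "\<xi> 0 = 0"
    proof -
      have "\<xi> (sA 0 0) = 0 * \<xi> 0" using * zero(2) unfolding dual_def linear_on_def by blast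
      then show ?thesis by simp
    qed
    have "t ?f ?g = (\<Sum>b\<leftarrow>bs. ?f (0, R b) * ?g (T b, 0))"
      unfolding t_def sum_list_apply2 by (simp add: pure2_def fg case_prod_unfold comp_def sum_list_apply2)
    also have "\<dots> = (\<Sum>b\<in>Bs. ?f (0, R b) * ?g (T b, 0))"
      using bs by (simp add: sum_list_distinct_conv_sum_set)
    also have "\<dots> = (\<Sum>b\<in>Bs. R b u * \<eta> (T b))"
      using zero dual TA Bs(2) xi0
      by (intro sum.cong) (auto simp: sd_functional_def sd_carrier_def)
    also have "\<dots> = \<eta> (\<Sum>b\<in>Bs. sA (R b u) (T b))"
      by (rule linear_on_sum[OF A.vector_space_axioms sub(1) vector_space_times \<eta>_lin, symmetric])
        (use TA Bs(2) in auto)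
    also have "(\<Sum>b\<in>Bs. sA (R b u) (T b)) = T (\<Sum>b\<in>Bs. sV (R b u) b)"
      by (rule linear_on_sum[OF V.vector_space_axioms sub(2) A.vector_space_axioms T, symmetric])
        (use Bs(2) in auto)
    also have "\<dots> = T u" using rep[OF *(3)] unfolding R_def by metis
    finally show "t ?f ?g = \<eta> (T u)" .
  qed
  moreover have "t1 = t2" if "t1 \<in> ?TS \<and> ?P t1" "t2 \<in> ?TS \<and> ?P t2" for t1 t2
  proof (intro ext)
    fix \<phi> \<psi>
    have out: "t' \<phi> \<psi> = 0" if "t' \<in> ?TS" "\<not> (\<phi> \<in> dual ?s ?B \<and> \<psi> \<in> dual ?s ?B)" for t'
    proof -
      from that(1) obtain xs where "t' = (\<Sum>(x, y)\<leftarrow>xs. pure2 ?s ?B x y)"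
        by (auto simp: tensor_square_def decomposes_def)
      moreover have "(\<Sum>(x, y)\<leftarrow>xs. pure2 ?s ?B x y) \<phi> \<psi> = 0"
        using that(2) by (induction xs) (auto simp: pure2_def)
      ultimately show ?thesis by simp
    qed
    show "t1 \<phi> \<psi> = t2 \<phi> \<psi>"
    proof (cases "\<phi> \<in> dual ?s ?B \<and> \<psi> \<in> dual ?s ?B")
      case False
      then show ?thesis using out that by metis
    next
      case True
      note surj = sd_functional_surj[OF A.vector_space_axioms sub(1) V]
      obtain \<xi> u where 1: "\<xi> \<in> dual sA A" "u \<in> V" "\<phi> = sd_functional A sV V \<xi> u"
        using surj True by blast
      obtain \<eta> v where 2: "\<eta> \<in> dual sA A" "v \<in> V" "\<psi> = sd_functional A sV V \<eta> v"
        using surj True by blast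
      show ?thesis using that 1 2 by metis
    qed
  qed
  ultimately show ?thesis by blast
qed

end

theory Submission
  imports Defs
begin

text \<open>
  Since \<open>r\<close> is symmetric, \<open>[[r,r]]\<close> evaluated on three functionals \<open>\<phi>\<^sub>i\<close> only involves products of the
  vectors \<open>r\<^sup>\<sharp>(\<phi>\<^sub>i \<circ> \<gamma>)\<close>. Every \<open>\<phi>\<^sub>i\<close> has the form \<open>\<xi>\<^sub>i + \<beta>\<^sup>2(w\<^sub>i)\<close>, and then this vector is
  \<open>S(w\<^sub>i) + \<xi>\<^sub>i \<circ> S\<close> with \<open>S = T \<circ> \<beta>\<close>. With
  \<open>O(u,v) = S(u) \<cdot> S(v) - S(\<rho>(T u) v + \<mu>(T v) u)\<close>, the bracket becomes
  \<open>\<langle>\<xi>\<^sub>3, O(w\<^sub>1,w\<^sub>2)\<rangle> + \<langle>\<xi>\<^sub>2, O(w\<^sub>1,w\<^sub>3) - O(w\<^sub>3,w\<^sub>1)\<rangle> - \<langle>\<xi>\<^sub>1, O(w\<^sub>3,w\<^sub>2)\<rangle>\<close>. It vanishes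
  identically iff \<open>O = 0\<close>; the remaining conditions on \<open>r\<close> follow from \<open>T \<circ> \<beta> = \<alpha> \<circ> T\<close>.
\<close>

subsection \<open>Duals and tensors\<close>

text \<open>The coordinates with respect to a basis are themselves functionals in the dual, so
  agreement under all functionals forces equal coordinates.\<close>

lemma fd_space_separated:
  assumes B: "fd_space s B" and x: "x \<in> B" and y: "y \<in> B"
    and eq: "\<And>\<eta>. \<eta> \<in> dual s B \<Longrightarrow> \<eta> x = \<eta> y"
  shows "x = y"
proof -
  from fd_space_dual_basis[OF B] obtain Bs where "finite Bs" "Bs \<subseteq> B"
    and dual: "\<And>b. (\<lambda>v. module.representation s Bs v b) \<in> dual s B"
    and rep: "\<And>v. v \<in> B \<Longrightarrow> v = (\<Sum>b\<in>Bs. s (module.representation s Bs v b) b)"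
    by blast
  have R: "module.representation s Bs x b = module.representation s Bs y b" for b
    using eq[OF dual] .
  have "x = (\<Sum>b\<in>Bs. s (module.representation s Bs x b) b)" by (rule rep[OF x])
  also have "\<dots> = (\<Sum>b\<in>Bs. s (module.representation s Bs y b) b)" unfolding R ..
  also have "\<dots> = y" by (rule rep[OF y, symmetric])
  finally show ?thesis .
qed

text \<open>Allows \<open>sharp\<close> to be computed by exhibiting a vector with the right
  pairings, without choosing a decomposition of the tensor.\<close>

lemma sharp_unique:
  assumes B: "fd_space s B" and x: "x \<in> B" and eq: "\<And>\<eta>. \<eta> \<in> dual s B \<Longrightarrow> \<eta> x = r \<xi> \<eta>"
  shows "sharp s B r \<xi> = x"
  unfolding sharp_def
proof (rule the_equality)
  show "x \<in> B \<and> (\<forall>\<eta>\<in>dual s B. \<eta> x = r \<xi> \<eta>)" using x eq by blast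
  fix z assume z: "z \<in> B \<and> (\<forall>\<eta>\<in>dual s B. \<eta> z = r \<xi> \<eta>)"
  show "z = x"
    by (rule fd_space_separated[OF B conjunct1[OF z] x]) (use z eq in metis)
qed

lemma transp_apply: "transp V f \<xi> v = (if v \<in> V then \<xi> (f v) else 0)"
  by (simp add: transp_def)

lemma transp_dual:
  assumes "fd_space s1 V" and f: "linear_on s1 s2 V W f" and \<xi>: "\<xi> \<in> dual s2 W"
  shows "transp V f \<xi> \<in> dual s1 V"
proof -
  have "vector_space s1" and sub: "module.subspace s1 V" using fd_space_subspace[OF assms(1)] by auto
  then interpret vector_space s1 by simp
  have "\<xi> (f (x + y)) = \<xi> (f x) + \<xi> (f y)" "\<xi> (f (s1 c x)) = c * \<xi> (f x)"
    if "x \<in> V" "y \<in> V" for x y c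
    using f \<xi> that by (simp_all add: linear_on_def dual_def)
  then show ?thesis
    using subspace_add[OF sub] subspace_scale[OF sub]
    by (simp add: dual_def linear_on_def transp_def)
qed

text \<open>The coordinate functionals \<open>R b\<close> form a finite spanning set: on the
  carrier, \<open>\<zeta>\<close> is the combination of the \<open>R b\<close> with coefficients
  \<open>\<zeta> b\<close>, and outside it both sides are 0.\<close>

lemma fd_space_dual:
  assumes V: "fd_space s V"
  shows "fd_space fun_scale (dual s V)"
proof -
  interpret F: vector_space "fun_scale :: 'a \<Rightarrow> ('b \<Rightarrow> 'a) \<Rightarrow> 'b \<Rightarrow> 'a"
    by unfold_locales (auto simp: fun_scale_def algebra_simps)
  have vs: "vector_space s" "module.subspace s V" using fd_space_subspace[OF V] by auto
  from fd_space_dual_basis[OF V] obtain Bs where Bs: "finite Bs" "Bs \<subseteq> V"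
    and dual: "\<And>b. (\<lambda>v. module.representation s Bs v b) \<in> dual s V"
    and rep: "\<And>v. v \<in> V \<Longrightarrow> v = (\<Sum>b\<in>Bs. s (module.representation s Bs v b) b)"
    by blast
  define R where "R b v = module.representation s Bs v b" for b v
  have dual: "R b \<in> dual s V" for b using dual unfolding R_def .
  have rep: "v = (\<Sum>b\<in>Bs. s (R b v) b)" if "v \<in> V" for v using rep[OF that] unfolding R_def .
  have "F.subspace (dual s V)"
    by (rule F.subspaceI) (auto simp: dual_closed, simp add: dual_def linear_on_def)
  then have "F.span (R ` Bs) \<subseteq> dual s V"
    using dual by (intro F.span_minimal) auto
  moreover have "\<zeta> \<in> F.span (R ` Bs)" if \<zeta>: "\<zeta> \<in> dual s V" for \<zeta>
  proof -
    have lin: "linear_on s (*) V UNIV \<zeta>" using \<zeta> by (simp add: dual_def)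
    have ap: "(\<Sum>b\<in>Bs. fun_scale (\<zeta> b) (R b)) v = (\<Sum>b\<in>Bs. R b v * \<zeta> b)" for v
      using Bs(1) by (induction Bs rule: finite_induct) (auto simp: fun_scale_def)
    have "\<zeta> v = (\<Sum>b\<in>Bs. fun_scale (\<zeta> b) (R b)) v" for v
    proof (cases "v \<in> V")
      case True
      then show ?thesis
        using linear_on_sum[OF vs vector_space_times lin, of Bs "\<lambda>b. b" "\<lambda>b. R b v"] Bs(2) rep[OF True]
        unfolding ap by auto
    next
      case False
      then have "\<zeta> v = 0" "\<And>b. R b v = 0" using \<zeta> dual by (auto simp: dual_def)
      then show ?thesis unfolding ap by simp
    qed
    then have eq: "\<zeta> = (\<Sum>b\<in>Bs. fun_scale (\<zeta> b) (R b))" by (intro ext)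
    show ?thesis by (subst eq, intro F.span_sum F.span_scale F.span_base) auto
  qed
  ultimately have "dual s V = F.span (R ` Bs)" by auto
  then show ?thesis
    unfolding fd_space_def using F.vector_space_axioms Bs(1) by blast
qed

lemma fd_space_Times:
  assumes "fd_space s1 U" "fd_space s2 W"
  shows "fd_space (module_prod.scale s1 s2) (U \<times> W)"
proof -
  interpret vector_space_prod s1 s2
    using assms by (simp add: vector_space_prod_def vector_space_pair_def fd_space_def)
  obtain X Y where X: "finite X" "U = vs1.span X" and Y: "finite Y" "W = vs2.span Y"
    using assms by (auto simp: fd_space_def)
  have "p.span (X \<times> {0} \<union> {0} \<times> Y) = U \<times> W"
    unfolding X Y by (auto simp: p.span_Un span_Times_sing1 span_Times_sing2)
  then show ?thesis
    unfolding fd_space_def using X Y p.vector_space_axioms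
    by (intro conjI exI[of _ "X \<times> {0} \<union> {0} \<times> Y"]) auto
qed

lemma fd_space_sd:
  assumes "fd_space sA A" "fd_space sV V"
  shows "fd_space (sd_scale sA) (sd_carrier A sV V)"
  unfolding sd_scale_def sd_carrier_def using assms by (intro fd_space_Times fd_space_dual)

text \<open>Freezing one argument of the product turns \<open>\<phi>\<close> into another functional
  in the dual, its pullback along a left or right multiplication. Expanding linearly in each
  argument in turn then gives the double sum.\<close>

lemma dual_bilinear_sum_list:
  assumes B: "fd_space s B" and m: "bilinear_on s s s B B B m" and \<phi>: "\<phi> \<in> dual s B"
    and f: "\<And>p. p \<in> set ps \<Longrightarrow> f p \<in> B" and g: "\<And>q. q \<in> set qs \<Longrightarrow> g q \<in> B"
  shows "\<phi> (m (\<Sum>p\<leftarrow>ps. s (c p) (f p)) (\<Sum>q\<leftarrow>qs. s (d q) (g q)))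
    = (\<Sum>p\<leftarrow>ps. \<Sum>q\<leftarrow>qs. c p * d q * \<phi> (m (f p) (g q)))"
proof -
  have vs: "vector_space s" "module.subspace s B" using fd_space_subspace[OF B] by auto
  define X Y where "X = (\<Sum>p\<leftarrow>ps. s (c p) (f p))" and "Y = (\<Sum>q\<leftarrow>qs. s (d q) (g q))"
  have X: "X \<in> B" unfolding X_def using dual_sum_list[OF vs \<phi> f, of ps "\<lambda>p. p" c] by simp
  have Y: "Y \<in> B" unfolding Y_def using dual_sum_list[OF vs \<phi> g, of qs "\<lambda>p. p" d] by simp
  have "transp B (\<lambda>x. m x Y) \<phi> \<in> dual s B"
    using m Y by (intro transp_dual[OF B _ \<phi>]) (auto simp: bilinear_on_def)
  from dual_sum_list[OF vs this f, of ps "\<lambda>p. p" c]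
  have "\<phi> (m X Y) = (\<Sum>p\<leftarrow>ps. c p * transp B (\<lambda>x. m x Y) \<phi> (f p))"
    using X unfolding X_def by (simp add: transp_def)
  also have "\<dots> = (\<Sum>p\<leftarrow>ps. \<Sum>q\<leftarrow>qs. c p * d q * \<phi> (m (f p) (g q)))"
  proof (rule arg_cong[where f = sum_list], rule map_cong[OF refl])
    fix p assume p: "p \<in> set ps"
    have "transp B (m (f p)) \<phi> \<in> dual s B"
      using m f[OF p] by (intro transp_dual[OF B _ \<phi>]) (auto simp: bilinear_on_def)
    from dual_sum_list[OF vs this g, of qs "\<lambda>p. p" d]
    have "\<phi> (m (f p) Y) = (\<Sum>q\<leftarrow>qs. d q * transp B (m (f p)) \<phi> (g q))"
      using Y unfolding Y_def by (simp add: transp_def)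
    also have "\<dots> = (\<Sum>q\<leftarrow>qs. d q * \<phi> (m (f p) (g q)))"
      by (rule arg_cong[where f = sum_list], rule map_cong[OF refl]) (simp add: transp_def g)
    finally show "c p * transp B (\<lambda>x. m x Y) \<phi> (f p)
        = (\<Sum>q\<leftarrow>qs. c p * d q * \<phi> (m (f p) (g q)))"
      using f[OF p] by (simp add: transp_def sum_list_const_mult mult.assoc)
  qed
  finally show ?thesis unfolding X_def Y_def .
qed

text \<open>For a symmetric tensor this yields a second decomposition of the same tensor, with the
  two factors exchanged.\<close>

lemma decomposes_swap:
  assumes "decomposes s B r xs"
  shows "decomposes s B (tensor_flip r) (map prod.swap xs)"
proof -
  have "tensor_flip r = (\<Sum>(x, y)\<leftarrow>map prod.swap xs. pure2 s B x y)"
    using assms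
    by (intro ext) (auto simp: decomposes_def tensor_flip_def sum_list_apply2 comp_def
        case_prod_unfold pure2_def mult.commute intro!: arg_cong[where f = sum_list])
  then show ?thesis using assms by (auto simp: decomposes_def)
qed

lemma tensor_square_closed:
  assumes "r \<in> tensor_square s B"
  shows "tensor_flip r \<in> tensor_square s B"
    and "t \<in> tensor_square s B \<Longrightarrow> r + t \<in> tensor_square s B"
proof -
  show "tensor_flip r \<in> tensor_square s B"
    using assms decomposes_swap unfolding tensor_square_def by blast
  assume "t \<in> tensor_square s B"
  then obtain xs ys where "decomposes s B r xs" "decomposes s B t ys"
    using assms unfolding tensor_square_def by blast
  then have "decomposes s B (r + t) (xs @ ys)" by (simp add: decomposes_def)
  then show "r + t \<in> tensor_square s B" unfolding tensor_square_def by blast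
qed

text \<open>
  Contracting a symmetric \<open>r\<close> with functionals turns the three terms of \<open>[[r,r]]\<close> into products
  of vectors in the image of \<open>r\<^sup>\<sharp>\<close>.
\<close>

lemma s_bracket_sharp:
  fixes s :: "'k::field \<Rightarrow> 'b::ab_group_add \<Rightarrow> 'b"
  assumes B: "fd_space s B" and m: "bilinear_on s s s B B B m" and g: "linear_on s s B B \<gamma>"
    and r: "r \<in> tensor_square s B" and sym: "tensor_flip r = r"
    and dual: "\<phi>1 \<in> dual s B" "\<phi>2 \<in> dual s B" "\<phi>3 \<in> dual s B"
  defines "P \<equiv> \<lambda>\<phi>. sharp s B r (transp B \<gamma> \<phi>)"
  shows "s_bracket s B m \<gamma> r \<phi>1 \<phi>2 \<phi>3
    = \<phi>2 (m (P \<phi>1) (P \<phi>3)) - \<phi>2 (m (P \<phi>3) (P \<phi>1)) - \<phi>1 (m (P \<phi>3) (P \<phi>2)) + \<phi>3 (m (P \<phi>1) (P \<phi>2))"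
proof -
  interpret vector_space s using B by (simp add: fd_space_def)
  have sub: "subspace B" using fd_space_subspace[OF B] by simp
  obtain xs where xs: "decomposes s B r xs" using r by (auto simp: tensor_square_def)
  have xsB: "fst p \<in> B" "snd p \<in> B" if "p \<in> set xs" for p
    using xs that by (auto simp: decomposes_def)
  have xs': "decomposes s B r (map prod.swap xs)" using decomposes_swap[OF xs] sym by simp
  \<comment> \<open>By symmetry \<open>\<phi>\<close> may be contracted with either factor of
    \<open>r\<close>. Each bracket term below uses the expansions that match the positions of its
    \<open>\<gamma>\<close>-factors.\<close>
  have P1: "P \<phi> = (\<Sum>p\<leftarrow>xs. s (\<phi> (\<gamma> (fst p))) (snd p))"
    and P2: "P \<phi> = (\<Sum>p\<leftarrow>xs. s (\<phi> (\<gamma> (snd p))) (fst p))" if "\<phi> \<in> dual s B" for \<phi>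
  proof -
    have t: "transp B \<gamma> \<phi> \<in> dual s B" by (rule transp_dual[OF B g that])
    show "P \<phi> = (\<Sum>p\<leftarrow>xs. s (\<phi> (\<gamma> (fst p))) (snd p))"
      unfolding P_def sharp_eq[OF B xs t] case_prod_unfold
      by (intro arg_cong[where f = sum_list] map_cong refl) (simp add: transp_def xsB)
    show "P \<phi> = (\<Sum>p\<leftarrow>xs. s (\<phi> (\<gamma> (snd p))) (fst p))"
      unfolding P_def sharp_eq[OF B xs' t] case_prod_unfold map_map
      by (intro arg_cong[where f = sum_list] map_cong refl) (simp add: transp_def xsB)
  qed
  have mB: "m x y \<in> B" if "x \<in> B" "y \<in> B" for x y
    using m that by (simp add: bilinear_on_def linear_on_def)
  have diff: "\<phi>2 (x - y) = \<phi>2 x - \<phi>2 y" if "x \<in> B" "y \<in> B" for x y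
  proof -
    have "\<phi>2 ((x - y) + y) = \<phi>2 (x - y) + \<phi>2 y"
      using dual(2) that subspace_diff[OF sub] unfolding dual_def linear_on_def by blast
    then show ?thesis by (simp add: algebra_simps)
  qed
  note bil = dual_bilinear_sum_list[OF B m, of _ xs _ xs]
  have T1: "\<phi>2 (m (P \<phi>1) (P \<phi>3))
      = (\<Sum>p\<leftarrow>xs. \<Sum>q\<leftarrow>xs. \<phi>1 (\<gamma> (fst p)) * \<phi>3 (\<gamma> (snd q)) * \<phi>2 (m (snd p) (fst q)))"
    unfolding P1[OF dual(1)] P2[OF dual(3)] by (rule bil) (use dual xsB in auto)
  have T2: "\<phi>2 (m (P \<phi>3) (P \<phi>1))
      = (\<Sum>p\<leftarrow>xs. \<Sum>q\<leftarrow>xs. \<phi>3 (\<gamma> (snd q)) * \<phi>1 (\<gamma> (fst p)) * \<phi>2 (m (fst q) (snd p)))"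
    unfolding P1[OF dual(1)] P2[OF dual(3)]
    \<comment> \<open>Here the index belonging to \<open>\<phi>3\<close> would come first;
      exchanging the sums aligns it with \<open>T1\<close>, so that both halves of the commutator
      run over the same \<open>p\<close> and \<open>q\<close>.\<close>
    by (subst sum_list_swap, rule bil) (use dual xsB in auto)
  have T3: "\<phi>1 (m (P \<phi>3) (P \<phi>2))
      = (\<Sum>p\<leftarrow>xs. \<Sum>q\<leftarrow>xs. \<phi>3 (\<gamma> (snd p)) * \<phi>2 (\<gamma> (snd q)) * \<phi>1 (m (fst p) (fst q)))"
    unfolding P2[OF dual(2)] P2[OF dual(3)] by (rule bil) (use dual xsB in auto)
  have T4: "\<phi>3 (m (P \<phi>1) (P \<phi>2))
      = (\<Sum>p\<leftarrow>xs. \<Sum>q\<leftarrow>xs. \<phi>1 (\<gamma> (fst p)) * \<phi>2 (\<gamma> (fst q)) * \<phi>3 (m (snd p) (snd q)))"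
    unfolding P1[OF dual(1)] P1[OF dual(2)] by (rule bil) (use dual xsB in auto)
  have "s_bracket s B m \<gamma> r \<phi>1 \<phi>2 \<phi>3 = (\<Sum>p\<leftarrow>xs. \<Sum>q\<leftarrow>xs.
        \<phi>1 (\<gamma> (fst p)) * \<phi>2 (commutator m (snd p) (fst q)) * \<phi>3 (\<gamma> (snd q))
      - \<phi>1 (m (fst p) (fst q)) * \<phi>2 (\<gamma> (snd q)) * \<phi>3 (\<gamma> (snd p))
      + \<phi>1 (\<gamma> (fst p)) * \<phi>2 (\<gamma> (fst q)) * \<phi>3 (m (snd p) (snd q)))"
    unfolding s_bracket_eq[OF B m g xs] s_bracket_sum_def
    by (simp add: sum_list_apply3 case_prod_unfold pure3_def dual)
  also have "\<dots> = (\<Sum>p\<leftarrow>xs. \<Sum>q\<leftarrow>xs.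
        \<phi>1 (\<gamma> (fst p)) * \<phi>3 (\<gamma> (snd q)) * \<phi>2 (m (snd p) (fst q))
      - \<phi>3 (\<gamma> (snd q)) * \<phi>1 (\<gamma> (fst p)) * \<phi>2 (m (fst q) (snd p))
      - \<phi>3 (\<gamma> (snd p)) * \<phi>2 (\<gamma> (snd q)) * \<phi>1 (m (fst p) (fst q))
      + \<phi>1 (\<gamma> (fst p)) * \<phi>2 (\<gamma> (fst q)) * \<phi>3 (m (snd p) (snd q)))"
    by (intro arg_cong[where f = sum_list] map_cong refl)
      (simp add: commutator_def diff mB xsB algebra_simps)
  also have "\<dots> = \<phi>2 (m (P \<phi>1) (P \<phi>3)) - \<phi>2 (m (P \<phi>3) (P \<phi>1))
      - \<phi>1 (m (P \<phi>3) (P \<phi>2)) + \<phi>3 (m (P \<phi>1) (P \<phi>2))"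
    unfolding T1 T2 T3 T4 by (simp only: sum_list_addf sum_list_subtractf)
  finally show ?thesis .
qed

text \<open>Every \<open>pure3\<close> vanishes off the dual, whichever list \<open>SOME\<close>
  selects. Hence the function equation \<open>s_bracket = 0\<close> only has to be tested on
  functionals in the dual.\<close>

lemma s_bracket_outside:
  assumes "\<not> (\<phi>1 \<in> dual s B \<and> \<phi>2 \<in> dual s B \<and> \<phi>3 \<in> dual s B)"
  shows "s_bracket s B m \<gamma> r \<phi>1 \<phi>2 \<phi>3 = 0"
  unfolding s_bracket_def s_bracket_sum_def using assms
  by (auto simp: sum_list_apply3 case_prod_unfold pure3_def)

subsection \<open>The semidirect product\<close>

lemma linear_on_inv_into:
  assumes V: "fd_space s V" and f: "linear_on s s V V f" and bij: "bij_betw f V V"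
  shows "linear_on s s V V (inv_into V f)"
proof -
  have "vector_space s" and sub: "module.subspace s V" using fd_space_subspace[OF V] by auto
  then interpret vector_space s by simp
  have inj: "inj_on f V" and im: "f ` V = V" using bij by (auto simp: bij_betw_def)
  have inv: "inv_into V f x \<in> V" "f (inv_into V f x) = x" if "x \<in> V" for x
    using that im inv_into_into[of x f V] f_inv_into_f[of x f V] by auto
  have "inv_into V f (x + y) = inv_into V f x + inv_into V f y"
    "inv_into V f (s c x) = s c (inv_into V f x)" if "x \<in> V" "y \<in> V" for x y c
    using f inv that subspace_add[OF sub] subspace_scale[OF sub]
    by (auto simp: linear_on_def intro!: inv_into_f_eq[OF inj])
  then show ?thesis using inv by (simp add: linear_on_def)
qed

locale regular_rep =
  fixes sA :: "'k::field \<Rightarrow> 'a::ab_group_add \<Rightarrow> 'a"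
    and A :: "'a set" and m :: "'a \<Rightarrow> 'a \<Rightarrow> 'a" and \<alpha> :: "'a \<Rightarrow> 'a"
    and sV :: "'k \<Rightarrow> 'v::ab_group_add \<Rightarrow> 'v"
    and V :: "'v set" and \<beta> :: "'v \<Rightarrow> 'v" and \<rho> \<mu> :: "'a \<Rightarrow> 'v \<Rightarrow> 'v"
  assumes regular: "regular_hom_pre_lie_algebra sA A m \<alpha>"
    and rep: "hom_pre_lie_rep sA A m \<alpha> sV V \<beta> \<rho> \<mu>"
    and bij_\<beta>: "bij_betw \<beta> V V"
begin

abbreviation "\<alpha>' \<equiv> inv_into A \<alpha>"
abbreviation "\<beta>' \<equiv> inv_into V \<beta>"
abbreviation "B \<equiv> sd_carrier A sV V"
abbreviation "sB \<equiv> sd_scale sA"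
abbreviation "mB \<equiv> sd_mult m \<alpha> V \<beta> \<rho> \<mu>"
abbreviation "\<gamma> \<equiv> sd_twist \<alpha> V \<beta>"
abbreviation "fn \<equiv> sd_functional A sV V"

lemma fd: "fd_space sA A" "fd_space sV V"
  using regular rep
  by (simp_all add: regular_hom_pre_lie_algebra_def hom_pre_lie_algebra_def hom_pre_lie_rep_def)

sublocale A: vector_space sA using fd by (simp add: fd_space_def)
sublocale V: vector_space sV using fd by (simp add: fd_space_def)

lemma sub: "A.subspace A" "V.subspace V"
  using fd_space_subspace fd by blast+

lemma closed [simp]:
  "x \<in> A \<Longrightarrow> y \<in> A \<Longrightarrow> x + y \<in> A" "x \<in> A \<Longrightarrow> sA c x \<in> A"
  "v \<in> V \<Longrightarrow> w \<in> V \<Longrightarrow> v + w \<in> V" "v \<in> V \<Longrightarrow> sV c v \<in> V"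
  using sub by (auto intro: A.subspace_add A.subspace_scale V.subspace_add V.subspace_scale)

lemma linear_maps:
  "linear_on sA sA A A \<alpha>" "linear_on sV sV V V \<beta>" "bilinear_on sA sA sA A A A m"
  "bilinear_on sA sV sV A V V \<rho>" "bilinear_on sA sV sV A V V \<mu>"
  "linear_on sV sV V V \<beta>'"
proof -
  show 1: "linear_on sA sA A A \<alpha>" "linear_on sV sV V V \<beta>" "bilinear_on sA sA sA A A A m"
    "bilinear_on sA sV sV A V V \<rho>" "bilinear_on sA sV sV A V V \<mu>"
    using regular rep
    by (auto simp: regular_hom_pre_lie_algebra_def hom_pre_lie_algebra_def hom_pre_lie_rep_def)
  show "linear_on sV sV V V \<beta>'" using linear_on_inv_into[OF fd(2) 1(2) bij_\<beta>] .
qed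

lemma bij_\<alpha>: "bij_betw \<alpha> A A"
  using regular by (simp add: regular_hom_pre_lie_algebra_def)

lemma maps_closed [simp]:
  "x \<in> A \<Longrightarrow> \<alpha> x \<in> A" "v \<in> V \<Longrightarrow> \<beta> v \<in> V" "x \<in> A \<Longrightarrow> y \<in> A \<Longrightarrow> m x y \<in> A"
  "x \<in> A \<Longrightarrow> v \<in> V \<Longrightarrow> \<rho> x v \<in> V" "x \<in> A \<Longrightarrow> v \<in> V \<Longrightarrow> \<mu> x v \<in> V"
  "v \<in> V \<Longrightarrow> \<beta>' v \<in> V" "x \<in> A \<Longrightarrow> \<alpha>' x \<in> A"
  using linear_maps bij_\<alpha> by (auto simp: linear_on_def bilinear_on_def bij_betw_def inv_into_into)

lemma inv_simps [simp]:
  "v \<in> V \<Longrightarrow> \<beta>' (\<beta> v) = v" "v \<in> V \<Longrightarrow> \<beta> (\<beta>' v) = v"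
  "x \<in> A \<Longrightarrow> \<alpha>' (\<alpha> x) = x" "x \<in> A \<Longrightarrow> \<alpha> (\<alpha>' x) = x"
  using bij_\<alpha> bij_\<beta>
  by (auto simp: bij_betw_inv_into_left bij_betw_inv_into_right)

lemma equivariant:
  "x \<in> A \<Longrightarrow> v \<in> V \<Longrightarrow> \<rho> (\<alpha> x) (\<beta> v) = \<beta> (\<rho> x v)"
  "x \<in> A \<Longrightarrow> v \<in> V \<Longrightarrow> \<mu> (\<alpha> x) (\<beta> v) = \<beta> (\<mu> x v)"
  using rep by (auto simp: hom_pre_lie_rep_def)

lemma maps_linear:
  "x \<in> A \<Longrightarrow> y \<in> A \<Longrightarrow> \<alpha> (x + y) = \<alpha> x + \<alpha> y" "x \<in> A \<Longrightarrow> \<alpha> (sA c x) = sA c (\<alpha> x)"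
  "v \<in> V \<Longrightarrow> w \<in> V \<Longrightarrow> \<beta>' (v + w) = \<beta>' v + \<beta>' w" "v \<in> V \<Longrightarrow> \<beta>' (sV c v) = sV c (\<beta>' v)"
  "x \<in> A \<Longrightarrow> y \<in> A \<Longrightarrow> z \<in> A \<Longrightarrow> m (x + y) z = m x z + m y z"
  "x \<in> A \<Longrightarrow> z \<in> A \<Longrightarrow> m (sA c x) z = sA c (m x z)"
  "x \<in> A \<Longrightarrow> y \<in> A \<Longrightarrow> z \<in> A \<Longrightarrow> m x (y + z) = m x y + m x z"
  "x \<in> A \<Longrightarrow> z \<in> A \<Longrightarrow> m x (sA c z) = sA c (m x z)"
  "x \<in> A \<Longrightarrow> y \<in> A \<Longrightarrow> v \<in> V \<Longrightarrow> \<rho> (x + y) v = \<rho> x v + \<rho> y v"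
  "x \<in> A \<Longrightarrow> v \<in> V \<Longrightarrow> \<rho> (sA c x) v = sV c (\<rho> x v)"
  "x \<in> A \<Longrightarrow> v \<in> V \<Longrightarrow> w \<in> V \<Longrightarrow> \<rho> x (v + w) = \<rho> x v + \<rho> x w"
  "x \<in> A \<Longrightarrow> v \<in> V \<Longrightarrow> \<rho> x (sV c v) = sV c (\<rho> x v)"
  "x \<in> A \<Longrightarrow> y \<in> A \<Longrightarrow> v \<in> V \<Longrightarrow> \<mu> (x + y) v = \<mu> x v + \<mu> y v"
  "x \<in> A \<Longrightarrow> v \<in> V \<Longrightarrow> \<mu> (sA c x) v = sV c (\<mu> x v)"
  "x \<in> A \<Longrightarrow> v \<in> V \<Longrightarrow> w \<in> V \<Longrightarrow> \<mu> x (v + w) = \<mu> x v + \<mu> x w"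
  "x \<in> A \<Longrightarrow> v \<in> V \<Longrightarrow> \<mu> x (sV c v) = sV c (\<mu> x v)"
  using linear_maps by (simp_all add: bilinear_on_def linear_on_def)

lemma dual_simps:
  "\<zeta> \<in> dual sV V \<Longrightarrow> v \<in> V \<Longrightarrow> w \<in> V \<Longrightarrow> \<zeta> (v + w) = \<zeta> v + \<zeta> w"
  "\<zeta> \<in> dual sV V \<Longrightarrow> v \<in> V \<Longrightarrow> \<zeta> (sV c v) = c * \<zeta> v"
  "\<zeta> \<in> dual sV V \<Longrightarrow> v \<notin> V \<Longrightarrow> \<zeta> v = 0"
  by (auto simp: dual_def linear_on_def)

text \<open>The minus sign in \<open>dual_action\<close> turns \<open>\<rho>\<close>-star minus
  \<open>\<mu>\<close>-star into \<open>\<mu>\<close> minus \<open>\<rho>\<close>, and minus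
  \<open>\<mu>\<close>-star into plus \<open>\<mu>\<close>. Membership in \<open>A\<close> keeps the
  action inside \<open>V\<close>, where the inner \<open>transp\<close> is not cut off to 0.\<close>

lemma sd_mult_eq:
  assumes "x \<in> A" "y \<in> A"
  shows "mB (x, \<zeta>) (y, \<eta>) = (m x y,
    transp V (\<lambda>v. \<beta>' (\<beta>' (\<mu> (\<alpha> x) v))) \<eta> - transp V (\<lambda>v. \<beta>' (\<beta>' (\<rho> (\<alpha> x) v))) \<eta>
    + transp V (\<lambda>v. \<beta>' (\<beta>' (\<mu> (\<alpha> y) v))) \<zeta>)"
  using assms
  by (auto simp: sd_mult_def semidirect_mult_def star_action_def dual_action_def transp_apply fun_eq_iff)

lemma sd_twist_eq: "\<gamma> (x, \<zeta>) = (\<alpha> x, transp V \<beta>' \<zeta>)"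
  by (simp add: sd_twist_def)

lemma sd_scale_eq: "sB c (x, \<zeta>) = (sA c x, fun_scale c \<zeta>)"
  by (simp add: sd_scale_apply[OF A.vector_space_axioms])

lemma sd_carrier_iff: "(x, \<zeta>) \<in> B \<longleftrightarrow> x \<in> A \<and> \<zeta> \<in> dual sV V"
  by (simp add: sd_carrier_def)

lemma fd_B: "fd_space sB B"
  using fd by (rule fd_space_sd)

lemma twist_dual: "\<zeta> \<in> dual sV V \<Longrightarrow> transp V \<beta>' \<zeta> \<in> dual sV V"
  by (rule transp_dual[OF fd(2) linear_maps(6)])

lemma linear_sd_twist: "linear_on sB sB B B \<gamma>"
  using twist_dual
  by (auto simp: linear_on_def sd_carrier_iff sd_twist_eq sd_scale_eq maps_linear
      transp_apply fun_scale_def fun_eq_iff)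

text \<open>Together with \<open>linear_sd_twist\<close> this makes the bracket independent of the
  decomposition and lets it be contracted with functionals.\<close>

lemma bilinear_sd_mult: "bilinear_on sB sB sB B B B mB"
proof -
  have "vector_space (fun_scale :: 'k \<Rightarrow> ('v \<Rightarrow> 'k) \<Rightarrow> 'v \<Rightarrow> 'k)"
    and dual: "module.subspace fun_scale (dual sV V)"
    using fd_space_subspace[OF fd_space_dual[OF fd(2)]] by auto
  then interpret F: vector_space "fun_scale :: 'k \<Rightarrow> ('v \<Rightarrow> 'k) \<Rightarrow> 'v \<Rightarrow> 'k" by simp
  have "transp V (\<lambda>v. \<beta>' (\<beta>' (\<mu> (\<alpha> x) v))) \<zeta> \<in> dual sV V"
    "transp V (\<lambda>v. \<beta>' (\<beta>' (\<rho> (\<alpha> x) v))) \<zeta> \<in> dual sV V"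
    if "x \<in> A" "\<zeta> \<in> dual sV V" for x \<zeta>
    by (rule transp_dual[OF fd(2) _ that(2)], use that in \<open>simp add: linear_on_def maps_linear\<close>)+
  then have "mB p q \<in> B" if "p \<in> B" "q \<in> B" for p q
    using that
    by (cases p; cases q)
      (simp add: sd_carrier_iff sd_mult_eq F.subspace_add[OF dual] F.subspace_diff[OF dual])
  moreover have "mB (p + p') q = mB p q + mB p' q" "mB (sB c p) q = sB c (mB p q)"
    "mB q (p + p') = mB q p + mB q p'" "mB q (sB c p) = sB c (mB q p)"
    if "p \<in> B" "p' \<in> B" "q \<in> B" for p p' q c
    using that
    by (cases p; cases p'; cases q; simp add: sd_carrier_iff sd_mult_eq sd_scale_eq maps_linear
        dual_simps transp_apply fun_scale_def fun_eq_iff algebra_simps)+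
  ultimately show ?thesis by (auto simp: bilinear_on_def linear_on_def)
qed

section \<open>Functionals on the semidirect product and their transport along the twist\<close>

lemma fn_dual: "\<xi> \<in> dual sA A \<Longrightarrow> u \<in> V \<Longrightarrow> fn \<xi> u \<in> dual sB B"
  by (rule sd_functional_dual[OF A.vector_space_axioms sub(1)])

lemma fn_surj:
  assumes "\<phi> \<in> dual sB B"
  obtains \<xi> u where "\<xi> \<in> dual sA A" "u \<in> V" "\<phi> = fn \<xi> u"
  using sd_functional_surj[OF A.vector_space_axioms sub(1) fd(2) assms] by blast

text \<open>Evaluating the transpose of \<open>\<beta>'\<close> applied to \<open>\<zeta>\<close> at
  \<open>u\<close> gives \<open>\<zeta> (\<beta>' u)\<close>: under the identification of
  \<open>V\<close> with its bidual, transposing twice returns \<open>\<beta>'\<close>.\<close>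

lemma transp_sd_twist:
  assumes "u \<in> V"
  shows "transp B \<gamma> (fn \<xi> u) = fn (transp A \<alpha> \<xi>) (\<beta>' u)"
proof
  fix p
  show "transp B \<gamma> (fn \<xi> u) p = fn (transp A \<alpha> \<xi>) (\<beta>' u) p"
    using assms
    by (cases p) (auto simp: transp_apply sd_functional_def sd_twist_eq sd_carrier_iff twist_dual)
qed

lemma inv_sd_twist:
  assumes "x \<in> A" "\<zeta> \<in> dual sV V"
  shows "inv_into B \<gamma> (x, \<zeta>) = (\<alpha>' x, transp V \<beta> \<zeta>)"
proof (rule inv_into_f_eq)
  show "inj_on \<gamma> B"
  proof (rule inj_onI)
    fix p q assume p: "p \<in> B" and q: "q \<in> B" and eq: "\<gamma> p = \<gamma> q"
    obtain y \<eta> z \<theta> where pq: "p = (y, \<eta>)" "q = (z, \<theta>)" by (cases p, cases q)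
    have "\<alpha> y = \<alpha> z" and tr: "transp V \<beta>' \<eta> = transp V \<beta>' \<theta>"
      using eq by (simp_all add: pq sd_twist_eq)
    then have "y = z" using p q pq bij_\<alpha> by (auto simp: sd_carrier_iff bij_betw_def inj_on_def)
    moreover have "\<eta> v = \<theta> v" for v
    proof (cases "v \<in> V")
      case True
      \<comment> \<open>At the point \<open>\<beta> v\<close> the inverse in the transpose cancels
        and the values at \<open>v\<close> reappear.\<close>
      then show ?thesis using fun_cong[OF tr, of "\<beta> v"] by (simp add: transp_def)
    next
      case False
      then show ?thesis using p q pq by (simp add: sd_carrier_iff dual_simps)
    qed
    ultimately show "p = q" by (auto simp: pq)
  qed
  show "(\<alpha>' x, transp V \<beta> \<zeta>) \<in> B"
    using assms transp_dual[OF fd(2) linear_maps(2)] by (simp add: sd_carrier_iff)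
  show "\<gamma> (\<alpha>' x, transp V \<beta> \<zeta>) = (x, \<zeta>)"
    using assms by (auto simp: sd_twist_eq transp_def fun_eq_iff dual_simps)
qed

lemma transp_inv_sd_twist:
  assumes "u \<in> V"
  shows "transp B (inv_into B \<gamma>) (fn \<xi> u) = fn (transp A \<alpha>' \<xi>) (\<beta> u)"
proof
  fix p
  show "transp B (inv_into B \<gamma>) (fn \<xi> u) p = fn (transp A \<alpha>' \<xi>) (\<beta> u) p"
    using assms transp_dual[OF fd(2) linear_maps(2)]
    by (cases p) (auto simp: transp_apply sd_functional_def sd_carrier_iff inv_sd_twist)
qed

end

subsection \<open>The bracket of the symmetrised tensor\<close>

text \<open>\<open>Tbar\<close> enters through its prescribed values; by
  \<open>bar_tensor_ex1\<close> exactly one tensor has them.\<close>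

locale equivariant_map = regular_rep sA A m \<alpha> sV V \<beta> \<rho> \<mu>
  for sA :: "'k::field \<Rightarrow> 'a::ab_group_add \<Rightarrow> 'a" and A m \<alpha>
    and sV :: "'k \<Rightarrow> 'v::ab_group_add \<Rightarrow> 'v" and V \<beta> \<rho> \<mu> +
  fixes T :: "'v \<Rightarrow> 'a" and Tbar :: "('a \<times> ('v \<Rightarrow> 'k), 'k) tensor2"
  assumes linear_T: "linear_on sV sA V A T"
    and T_\<beta>: "\<And>u. u \<in> V \<Longrightarrow> T (\<beta> u) = \<alpha> (T u)"
    and Tbar: "Tbar \<in> tensor_square (sd_scale sA) (sd_carrier A sV V)"
    and Tbar_apply: "\<And>\<xi> \<eta> u v. \<xi> \<in> dual sA A \<Longrightarrow> \<eta> \<in> dual sA A \<Longrightarrow> u \<in> V \<Longrightarrow> v \<in> V \<Longrightarrow>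
      Tbar (sd_functional A sV V \<xi> u) (sd_functional A sV V \<eta> v) = \<eta> (T u)"
begin

abbreviation "r \<equiv> Tbar + tensor_flip Tbar"

text \<open>On \<open>V\<close>, \<open>T\<close> equals \<open>(T \<circ> \<beta>) \<circ> \<beta>\<^sup>-\<^sup>1\<close>, which is how \<open>\<beta>\<^sup>-\<^sup>1\<close> disappears.\<close>

definition "O_defect u v = m (T (\<beta> u)) (T (\<beta> v)) - T (\<beta> (\<rho> (T u) v + \<mu> (T v) u))"

lemma T_closed [simp]: "u \<in> V \<Longrightarrow> T u \<in> A"
  using linear_T by (simp add: linear_on_def)

lemma r_symmetric: "tensor_flip r = r"
  by (auto simp: tensor_flip_def fun_eq_iff add.commute)

lemma r_tensor: "r \<in> tensor_square sB B"
  using Tbar by (intro tensor_square_closed)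

text \<open>Pairing with \<open>fn \<eta> v\<close> gives \<open>\<eta> (T u)\<close> from
  \<open>Tbar\<close> and \<open>\<xi> (T v)\<close> from its flip. The first is the
  \<open>A\<close>-component \<open>T u\<close>, the second the transpose of \<open>T\<close> at
  \<open>\<xi>\<close>.\<close>

lemma sharp_r:
  assumes \<xi>: "\<xi> \<in> dual sA A" and u: "u \<in> V"
  shows "sharp sB B r (fn \<xi> u) = (T u, transp V T \<xi>)"
proof (rule sharp_unique[OF fd_B])
  have t: "transp V T \<xi> \<in> dual sV V" by (rule transp_dual[OF fd(2) linear_T \<xi>])
  then show B: "(T u, transp V T \<xi>) \<in> B" using u by (simp add: sd_carrier_iff)
  fix \<psi> assume "\<psi> \<in> dual sB B"
  then obtain \<eta> v where \<eta>: "\<eta> \<in> dual sA A" and v: "v \<in> V" and \<psi>: "\<psi> = fn \<eta> v" by (rule fn_surj)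
  show "\<psi> (T u, transp V T \<xi>) = r (fn \<xi> u) \<psi>"
    using B v Tbar_apply[OF \<xi> \<eta> u v] Tbar_apply[OF \<eta> \<xi> v u]
    by (simp add: \<psi> tensor_flip_def sd_functional_def[of _ _ _ \<eta>] transp_def)
qed

text \<open>The \<open>A\<close>-component is \<open>T (\<beta> u) = \<alpha> (T u)\<close>; the
  dual component is the same relation for the inverses,
  \<open>\<alpha>' (T v) = T (\<beta>' v)\<close>.\<close>

lemma sharp_r_twist:
  assumes "\<phi> \<in> dual sB B"
  shows "sharp sB B r (transp B (inv_into B \<gamma>) \<phi>) = \<gamma> (sharp sB B r \<phi>)"
proof -
  obtain \<xi> u where \<xi>: "\<xi> \<in> dual sA A" and u: "u \<in> V" and \<phi>: "\<phi> = fn \<xi> u"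
    using assms by (rule fn_surj)
  have "transp A \<alpha>' \<xi> \<in> dual sA A"
    using linear_on_inv_into[OF fd(1) linear_maps(1) bij_\<alpha>] \<xi> by (rule transp_dual[OF fd(1)])
  moreover have "\<alpha>' (T v) = T (\<beta>' v)" if "v \<in> V" for v
    using T_\<beta>[of "\<beta>' v"] that by (metis T_closed inv_simps(2,3) maps_closed(6))
  ultimately show ?thesis
    using \<xi> u T_\<beta>
    by (auto simp: \<phi> transp_inv_sd_twist sharp_r sd_twist_eq transp_apply fun_eq_iff)
qed

text \<open>Writing the vectors as \<open>\<beta> (\<beta> w)\<close> removes all inverses: pulling
  back along \<open>\<gamma>\<close> uses up one \<open>\<beta>\<close> in each factor, and
  evaluation at \<open>\<beta> (\<beta> w3)\<close> cancels the inverse square of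
  \<open>\<beta>\<close> in the dual actions.\<close>

lemma fn_sharp_mult:
  assumes "\<xi>1 \<in> dual sA A" "\<xi>2 \<in> dual sA A" "\<xi>3 \<in> dual sA A" "w1 \<in> V" "w2 \<in> V" "w3 \<in> V"
  shows "fn \<xi>3 (\<beta> (\<beta> w3)) (mB (sharp sB B r (transp B \<gamma> (fn \<xi>1 (\<beta> (\<beta> w1)))))
      (sharp sB B r (transp B \<gamma> (fn \<xi>2 (\<beta> (\<beta> w2))))))
    = \<xi>3 (m (T (\<beta> w1)) (T (\<beta> w2))) + \<xi>2 (T (\<beta> (\<mu> (T w1) w3))) - \<xi>2 (T (\<beta> (\<rho> (T w1) w3)))
      + \<xi>1 (T (\<beta> (\<mu> (T w2) w3)))"
proof -
  have P: "sharp sB B r (transp B \<gamma> (fn \<xi> (\<beta> (\<beta> w))))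
      = (T (\<beta> w), \<lambda>v. if v \<in> V then \<xi> (T (\<beta> v)) else 0)" if "\<xi> \<in> dual sA A" "w \<in> V" for \<xi> w
    using that transp_dual[OF fd(1) linear_maps(1)] T_\<beta>
    by (simp add: transp_sd_twist sharp_r) (auto simp: transp_def)
  have PB: "(T (\<beta> w), \<lambda>v. if v \<in> V then \<xi> (T (\<beta> v)) else 0) \<in> B"
    if "\<xi> \<in> dual sA A" "w \<in> V" for \<xi> w
    using that transp_dual[OF fd(2) linear_T transp_dual[OF fd(1) linear_maps(1)]] T_\<beta>
    by (auto simp: sd_carrier_iff transp_def cong: if_cong)
  \<comment> \<open>\<open>sd_functional\<close> is 0 off the carrier, so it can be evaluated on the
    product only once membership is known.\<close>
  have mem: "mB p q \<in> B" if "p \<in> B" "q \<in> B" for p q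
    using bilinear_sd_mult that by (simp add: bilinear_on_def linear_on_def)
  \<comment> \<open>Since \<open>T (\<beta> w) = \<alpha> (T w)\<close>, the algebra argument is
    \<open>\<alpha> (\<alpha> (T w))\<close>; equivariance applied twice moves both
    \<open>\<beta>\<close> outside.\<close>
  have eq: "\<beta>' (\<beta>' (\<rho> (\<alpha> (T (\<beta> w))) (\<beta> (\<beta> v)))) = \<rho> (T w) v"
    "\<beta>' (\<beta>' (\<mu> (\<alpha> (T (\<beta> w))) (\<beta> (\<beta> v)))) = \<mu> (T w) v" if "w \<in> V" "v \<in> V" for w v
    using that by (simp_all add: T_\<beta> equivariant)
  show ?thesis
    using mem[OF PB[OF assms(1,4)] PB[OF assms(2,5)]] assms
    by (simp add: P sd_functional_def[of _ _ _ \<xi>3] sd_mult_eq eq transp_apply)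
qed

section \<open>From the bracket to the defect of the operator equation\<close>

lemma dual_A_simps:
  assumes "\<xi> \<in> dual sA A" "x \<in> A" "y \<in> A"
  shows "\<xi> (x + y) = \<xi> x + \<xi> y" "\<xi> (x - y) = \<xi> x - \<xi> y"
proof -
  show "\<xi> (x + y) = \<xi> x + \<xi> y" using assms by (simp add: dual_def linear_on_def)
  have "\<xi> ((x - y) + y) = \<xi> (x - y) + \<xi> y"
    using assms A.subspace_diff[OF sub(1)] unfolding dual_def linear_on_def by blast
  then show "\<xi> (x - y) = \<xi> x - \<xi> y" by (simp add: algebra_simps)
qed

lemma dual_A_zero: "\<xi> \<in> dual sA A \<Longrightarrow> \<xi> 0 = 0"
  using dual_A_simps(2)[of \<xi> 0 0] A.subspace_0[OF sub(1)] by simp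

lemma O_defect_closed: "u \<in> V \<Longrightarrow> v \<in> V \<Longrightarrow> O_defect u v \<in> A"
  unfolding O_defect_def by (intro A.subspace_diff sub) auto

lemma dual_O_defect:
  assumes "\<xi> \<in> dual sA A" "u \<in> V" "v \<in> V"
  shows "\<xi> (O_defect u v)
    = \<xi> (m (T (\<beta> u)) (T (\<beta> v))) - \<xi> (T (\<beta> (\<rho> (T u) v))) - \<xi> (T (\<beta> (\<mu> (T v) u)))"
proof -
  have "T (\<beta> (\<rho> (T u) v + \<mu> (T v) u)) = T (\<beta> (\<rho> (T u) v)) + T (\<beta> (\<mu> (T v) u))"
    using linear_maps(2) linear_T assms by (simp add: linear_on_def)
  then show ?thesis using assms by (simp add: O_defect_def dual_A_simps)
qed

text \<open>Expand the four products with \<open>fn_sharp_mult\<close>. In the commutator paired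
  with the second functional, the \<open>\<mu>\<close>-terms carrying \<open>\<xi>1\<close> and
  \<open>\<xi>3\<close> cancel; collecting the rest by \<open>\<xi>1\<close>, \<open>\<xi>2\<close>,
  \<open>\<xi>3\<close> leaves exactly defects.\<close>

lemma s_bracket_r:
  assumes "\<xi>1 \<in> dual sA A" "\<xi>2 \<in> dual sA A" "\<xi>3 \<in> dual sA A" "w1 \<in> V" "w2 \<in> V" "w3 \<in> V"
  shows "s_bracket sB B mB \<gamma> r (fn \<xi>1 (\<beta> (\<beta> w1))) (fn \<xi>2 (\<beta> (\<beta> w2))) (fn \<xi>3 (\<beta> (\<beta> w3)))
    = \<xi>3 (O_defect w1 w2) + \<xi>2 (O_defect w1 w3) - \<xi>2 (O_defect w3 w1) - \<xi>1 (O_defect w3 w2)"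
  using assms
  by (subst s_bracket_sharp[OF fd_B bilinear_sd_mult linear_sd_twist r_tensor r_symmetric])
    (simp_all add: fn_dual fn_sharp_mult dual_O_defect)

lemma s_bracket_r_eq_0_iff:
  "s_bracket sB B mB \<gamma> r = 0 \<longleftrightarrow> (\<forall>u\<in>V. \<forall>v\<in>V. O_defect u v = 0)"
proof
  assume bracket: "s_bracket sB B mB \<gamma> r = 0"
  show "\<forall>u\<in>V. \<forall>v\<in>V. O_defect u v = 0"
  proof (intro ballI)
    fix u v assume uv: "u \<in> V" "v \<in> V"
    \<comment> \<open>With \<open>\<xi>1\<close> and \<open>\<xi>2\<close> zero, only
      \<open>\<xi> (O_defect u v)\<close> survives in the bracket. The third vector may be any
      element of \<open>V\<close>; it is taken to be \<open>u\<close>.\<close>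
    have zero: "(\<lambda>x. 0) \<in> dual sA A" by (simp add: dual_def linear_on_def)
    show "O_defect u v = 0"
    proof (rule fd_space_separated[OF fd(1) O_defect_closed[OF uv] A.subspace_0[OF sub(1)]])
      fix \<xi> assume \<xi>: "\<xi> \<in> dual sA A"
      show "\<xi> (O_defect u v) = \<xi> 0"
        using dual_A_zero[OF \<xi>] s_bracket_r[OF zero zero \<xi> uv uv(1)] bracket by simp
    qed
  qed
next
  assume defect: "\<forall>u\<in>V. \<forall>v\<in>V. O_defect u v = 0"
  show "s_bracket sB B mB \<gamma> r = 0"
  proof (intro ext)
    fix \<phi>1 \<phi>2 \<phi>3
    \<comment> \<open>Bijectivity of \<open>\<beta>\<close> brings every functional into the form
      required by \<open>s_bracket_r\<close>.\<close>
    have repr: "\<exists>\<xi> w. \<xi> \<in> dual sA A \<and> w \<in> V \<and> \<phi> = fn \<xi> (\<beta> (\<beta> w))" if \<phi>: "\<phi> \<in> dual sB B" for \<phi>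
    proof -
      obtain \<xi> u where "\<xi> \<in> dual sA A" "u \<in> V" "\<phi> = fn \<xi> u" using \<phi> by (rule fn_surj)
      then show ?thesis by (intro exI[of _ \<xi>] exI[of _ "\<beta>' (\<beta>' u)"]) simp
    qed
    show "s_bracket sB B mB \<gamma> r \<phi>1 \<phi>2 \<phi>3 = 0 \<phi>1 \<phi>2 \<phi>3"
    proof (cases "\<phi>1 \<in> dual sB B \<and> \<phi>2 \<in> dual sB B \<and> \<phi>3 \<in> dual sB B")
      case True
      then obtain \<xi>1 \<xi>2 \<xi>3 w1 w2 w3 where
        \<xi>: "\<xi>1 \<in> dual sA A" "\<xi>2 \<in> dual sA A" "\<xi>3 \<in> dual sA A" and w: "w1 \<in> V" "w2 \<in> V" "w3 \<in> V"
        and \<phi>: "\<phi>1 = fn \<xi>1 (\<beta> (\<beta> w1))" "\<phi>2 = fn \<xi>2 (\<beta> (\<beta> w2))" "\<phi>3 = fn \<xi>3 (\<beta> (\<beta> w3))"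
        using repr by meson
      show ?thesis unfolding \<phi> s_bracket_r[OF \<xi> w] using defect w \<xi> by (simp add: dual_A_zero)
    qed (simp add: s_bracket_outside)
  qed
qed

text \<open>For \<open>S = T \<circ> \<beta>\<close>, \<open>S (\<beta>' u)\<close> is
  \<open>T u\<close>, so the product condition says that the defect vanishes;
  \<open>S (\<beta> u) = \<alpha> (S u)\<close> is inherited from \<open>T\<close>.\<close>

lemma hom_O_operator_iff:
  "hom_O_operator sA A m \<alpha> sV V \<beta> \<rho> \<mu> (T \<circ> \<beta>) \<longleftrightarrow> (\<forall>u\<in>V. \<forall>v\<in>V. O_defect u v = 0)"
proof -
  have "linear_on sV sA V A (T \<circ> \<beta>)"
    using linear_maps(2) linear_T by (simp add: linear_on_def)
  then show ?thesis
    by (simp add: hom_O_operator_def O_defect_def T_\<beta>)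
qed

lemma hom_s_matrix_iff:
  "hom_s_matrix sB B mB \<gamma> r \<longleftrightarrow> hom_O_operator sA A m \<alpha> sV V \<beta> \<rho> \<mu> (T \<circ> \<beta>)"
  unfolding hom_s_matrix_def hom_O_operator_iff s_bracket_r_eq_0_iff
  using r_tensor r_symmetric sharp_r_twist by blast

end

theorem theorem5p14:
  fixes sA :: "'k::field \<Rightarrow> 'a::ab_group_add \<Rightarrow> 'a"
    and A :: "'a set" and m :: "'a \<Rightarrow> 'a \<Rightarrow> 'a" and \<alpha> :: "'a \<Rightarrow> 'a"
    and sV :: "'k \<Rightarrow> 'v::ab_group_add \<Rightarrow> 'v"
    and V :: "'v set" and \<beta> :: "'v \<Rightarrow> 'v" and \<rho> \<mu> :: "'a \<Rightarrow> 'v \<Rightarrow> 'v"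
    and T :: "'v \<Rightarrow> 'a"
    and Tbar :: "('a \<times> ('v \<Rightarrow> 'k), 'k) tensor2"
  assumes "regular_hom_pre_lie_algebra sA A m \<alpha>"
    and "hom_pre_lie_rep sA A m \<alpha> sV V \<beta> \<rho> \<mu>"
    and "bij_betw \<beta> V V"
    and "linear_on sV sA V A T"
    and "\<And>u. u \<in> V \<Longrightarrow> T (\<beta> u) = \<alpha> (T u)"
    and "Tbar \<in> tensor_square (sd_scale sA) (sd_carrier A sV V)"
    and "\<And>\<xi> \<eta> u v. \<xi> \<in> dual sA A \<Longrightarrow> \<eta> \<in> dual sA A \<Longrightarrow> u \<in> V \<Longrightarrow> v \<in> V \<Longrightarrow>
           Tbar (sd_functional A sV V \<xi> u) (sd_functional A sV V \<eta> v) = \<eta> (T u)"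
  shows "hom_s_matrix (sd_scale sA) (sd_carrier A sV V) (sd_mult m \<alpha> V \<beta> \<rho> \<mu>) (sd_twist \<alpha> V \<beta>)
           (Tbar + tensor_flip Tbar)
         \<longleftrightarrow> hom_O_operator sA A m \<alpha> sV V \<beta> \<rho> \<mu> (T \<circ> \<beta>)"
proof -
  interpret equivariant_map sA A m \<alpha> sV V \<beta> \<rho> \<mu> T Tbar
    by unfold_locales fact+
  show ?thesis by (rule hom_s_matrix_iff)
qed

end
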